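(* Let $Y$ be a real Banach space of dimension at least two and $(\Omega,\Sigma,\mu)$ a measure space such that the real space $L_\infty(\mu)$ has dimension at least two. Then the subspace $\mathcal K(L_\infty(\mu),Y)$ has the BPBp-RSE if and only if $Y$ is uniformly convex.
   Context: All Banach spaces here are real; $B_X$, $S_X$ are the closed unit ball and unit sphere of $X$; $\mathbb T=\{1,-1\}$; $\mathcal L(X,Y)$ and $\mathcal K(X,Y)$ are the spaces of bounded and of compact linear operators. An operator $T\in\mathcal L(X,Y)$ is range strongly exposing, $T\in\mathrm{RSE}(X,Y)$, if there is $x_0\in S_X$ such that whenever $(x_n)\subseteq B_X$ satisfies $\|Tx_n\|\to\|T\|$, there are a subsequence $(x_{\sigma(n)})$ and $\lambda\in\mathbb T$ with $Tx_{\sigma(n)}\to\lambda Tx_0$. A linear subspace $\mathcal M\subseteq\mathcal L(X,Y)$ has the BPBp-RSE if for every $\varepsilon>0$ there is $0<\eta(\varepsilon)<\varepsilon$ such that for every $T\in\mathcal M$ with $\|T\|=1$ and every $x\in S_X$ with $\|Tx\|>1-\eta(\varepsilon)$, there exist $S\in\mathrm{RSE}(X,Y)\cap\mathcal M$ and $x_0\in S_X$ with $\|S\|=\|Sx_0\|=1$, $\|S-T\|<\varepsilon$ and $\|x-x_0\|<\varepsilon$. $Y$ is uniformly convex if for every $\varepsilon>0$ there is $0<\delta<1$ such that $y_1,y_2\in S_Y$ and $\|y_1+y_2\|/2>1-\delta$ imply $\|y_1-y_2\|<\varepsilon$. *)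

theory Defs
  imports "HOL-Probability.Essential_Supremum"
begin

section \<open>Real normed spaces with an explicit carrier\<close>

text \<open>
  The space L-infinity of a measure depends on the measure, which is a term, so it cannot be a
  type of class \<^class>\<open>real_normed_vector\<close>.  Domain spaces are therefore given by
  a record; range spaces are types.
\<close>

record 'x nspace =
  carr :: "'x set"
  nzero :: 'x
  nadd :: "'x \<Rightarrow> 'x \<Rightarrow> 'x"
  nscale :: "real \<Rightarrow> 'x \<Rightarrow> 'x"
  nnorm :: "'x \<Rightarrow> real"

definition ndiff :: "'x nspace \<Rightarrow> 'x \<Rightarrow> 'x \<Rightarrow> 'x" where
  "ndiff X x y = nadd X x (nscale X (-1) y)"

definition unit_ball :: "'x nspace \<Rightarrow> 'x set" where
  "unit_ball X = {x \<in> carr X. nnorm X x \<le> 1}"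

definition unit_sphere :: "'x nspace \<Rightarrow> 'x set" where
  "unit_sphere X = {x \<in> carr X. nnorm X x = 1}"

definition ndim_ge_2 :: "'x nspace \<Rightarrow> bool" where
  "ndim_ge_2 X \<longleftrightarrow> (\<exists>x\<in>carr X. \<exists>y\<in>carr X. \<forall>a b.
     nadd X (nscale X a x) (nscale X b y) = nzero X \<longrightarrow> a = 0 \<and> b = 0)"

section \<open>Operators\<close>

text \<open>
  An operator is extended by zero outside the carrier, so that operators agreeing on the carrier
  are equal and the pointwise difference of two operators is an operator.
\<close>

definition bdd_ops :: "'x nspace \<Rightarrow> ('x \<Rightarrow> 'y::real_normed_vector) set" where
  "bdd_ops X = {T.
     (\<forall>x\<in>carr X. \<forall>y\<in>carr X. T (nadd X x y) = T x + T y) \<and>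
     (\<forall>c. \<forall>x\<in>carr X. T (nscale X c x) = c *\<^sub>R T x) \<and>
     (\<exists>C. \<forall>x\<in>carr X. norm (T x) \<le> C * nnorm X x) \<and>
     (\<forall>x. x \<notin> carr X \<longrightarrow> T x = 0)}"

definition op_norm :: "'x nspace \<Rightarrow> ('x \<Rightarrow> 'y::real_normed_vector) \<Rightarrow> real" where
  "op_norm X T = (SUP x\<in>unit_ball X. norm (T x))"

definition compact_ops :: "'x nspace \<Rightarrow> ('x \<Rightarrow> 'y::real_normed_vector) set" where
  "compact_ops X = {T \<in> bdd_ops X. compact (closure (T ` unit_ball X))}"

definition RSE :: "'x nspace \<Rightarrow> ('x \<Rightarrow> 'y::real_normed_vector) set" where
  "RSE X = {T \<in> bdd_ops X. \<exists>x0\<in>unit_sphere X. \<forall>u::nat \<Rightarrow> 'x.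
     (\<forall>n. u n \<in> unit_ball X) \<and> (\<lambda>n. norm (T (u n))) \<longlonglongrightarrow> op_norm X T \<longrightarrow>
     (\<exists>\<sigma>::nat \<Rightarrow> nat. strict_mono \<sigma> \<and>
        (\<exists>\<theta>\<in>{1, -1::real}. (\<lambda>n. T (u (\<sigma> n))) \<longlonglongrightarrow> \<theta> *\<^sub>R T x0))}"

definition BPBp_RSE :: "'x nspace \<Rightarrow> ('x \<Rightarrow> 'y::real_normed_vector) set \<Rightarrow> bool" where
  "BPBp_RSE X \<M> \<longleftrightarrow> (\<forall>\<epsilon>>0. \<exists>\<eta>. 0 < \<eta> \<and> \<eta> < \<epsilon> \<and>
     (\<forall>T\<in>\<M>. \<forall>x\<in>unit_sphere X. op_norm X T = 1 \<and> norm (T x) > 1 - \<eta> \<longrightarrow>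
        (\<exists>S \<in> RSE X \<inter> \<M>. \<exists>x0\<in>unit_sphere X.
           op_norm X S = 1 \<and> norm (S x0) = 1 \<and>
           op_norm X (\<lambda>z. S z - T z) < \<epsilon> \<and> nnorm X (ndiff X x x0) < \<epsilon>)))"

section \<open>Uniform convexity\<close>

definition uniformly_convex :: "'y::real_normed_vector itself \<Rightarrow> bool" where
  "uniformly_convex _ \<longleftrightarrow> (\<forall>\<epsilon>>0. \<exists>\<delta>. 0 < \<delta> \<and> \<delta> < (1::real) \<and>
     (\<forall>y1 y2 :: 'y. norm y1 = 1 \<and> norm y2 = 1 \<and> norm (y1 + y2) / 2 > 1 - \<delta> \<longrightarrow>
        norm (y1 - y2) < \<epsilon>))"

section \<open>The real space L-infinity of a measure\<close>

definition ess_norm :: "'a measure \<Rightarrow> ('a \<Rightarrow> real) \<Rightarrow> ennreal" where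
  "ess_norm M f = esssup M (\<lambda>x. ennreal \<bar>f x\<bar>)"

definition ess_bounded :: "'a measure \<Rightarrow> ('a \<Rightarrow> real) set" where
  "ess_bounded M = {f \<in> borel_measurable M. ess_norm M f < \<infinity>}"

definition ae_rel :: "'a measure \<Rightarrow> (('a \<Rightarrow> real) \<times> ('a \<Rightarrow> real)) set" where
  "ae_rel M = {(f, g). f \<in> ess_bounded M \<and> g \<in> ess_bounded M \<and> (AE x in M. f x = g x)}"

definition Linf :: "'a measure \<Rightarrow> ('a \<Rightarrow> real) set nspace" where
  "Linf M = \<lparr>
     carr = ess_bounded M // ae_rel M,
     nzero = ae_rel M `` {\<lambda>x. 0},
     nadd = (\<lambda>F G. \<Union>f\<in>F. \<Union>g\<in>G. ae_rel M `` {\<lambda>x. f x + g x}),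
     nscale = (\<lambda>c F. \<Union>f\<in>F. ae_rel M `` {\<lambda>x. c * f x}),
     nnorm = (\<lambda>F. the_elem ((\<lambda>f. enn2real (ess_norm M f)) ` F)) \<rparr>"

text \<open>The operations are independent of the representatives.\<close>

lemma ess_bounded_iff:
  "f \<in> ess_bounded M \<longleftrightarrow> f \<in> borel_measurable M \<and> (\<exists>C. AE x in M. \<bar>f x\<bar> \<le> C)"
proof (cases "f \<in> borel_measurable M")
  case True
  then have m: "(\<lambda>x. ennreal \<bar>f x\<bar>) \<in> borel_measurable M" by measurable
  have "\<exists>C. AE x in M. \<bar>f x\<bar> \<le> C" if "ess_norm M f < \<infinity>"
  proof -
    have "AE x in M. ennreal \<bar>f x\<bar> \<le> ennreal (enn2real (ess_norm M f))"
      using esssup_AE[of "\<lambda>x. ennreal \<bar>f x\<bar>" M] that by (simp add: ess_norm_def)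
    then show ?thesis by auto
  qed
  moreover have "ess_norm M f < \<infinity>" if "AE x in M. \<bar>f x\<bar> \<le> C" for C
  proof -
    have "esssup M (\<lambda>x. ennreal \<bar>f x\<bar>) \<le> ennreal C"
      using that by (intro esssup_I[OF m]) (auto elim!: eventually_mono intro: ennreal_leI)
    then show ?thesis unfolding ess_norm_def
      by (metis ennreal_less_top infinity_ennreal_def le_less_trans)
  qed
  ultimately show ?thesis using True by (auto simp: ess_bounded_def)
qed (simp add: ess_bounded_def)

lemma equiv_ae_rel: "equiv (ess_bounded M) (ae_rel M)"
proof (rule equivI)
  show "ae_rel M \<subseteq> ess_bounded M \<times> ess_bounded M" by (auto simp: ae_rel_def)
  show "refl_on (ess_bounded M) (ae_rel M)" by (simp add: ae_rel_def refl_on_def)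
  have "AE x in M. g x = f x" if "AE x in M. f x = g x" for f g :: "'a \<Rightarrow> real"
    using that by eventually_elim simp
  then show "sym (ae_rel M)" unfolding ae_rel_def sym_def by blast
  have "AE x in M. f x = h x" if "AE x in M. f x = g x" "AE x in M. g x = h x"
    for f g h :: "'a \<Rightarrow> real"
    using that by eventually_elim simp
  then show "trans (ae_rel M)" unfolding ae_rel_def trans_def by blast
qed

lemma ess_bounded_add:
  assumes "f \<in> ess_bounded M" "g \<in> ess_bounded M"
  shows "(\<lambda>x. f x + g x) \<in> ess_bounded M"
proof -
  from assms obtain C D where "AE x in M. \<bar>f x\<bar> \<le> C" "AE x in M. \<bar>g x\<bar> \<le> D"
    by (auto simp: ess_bounded_iff)
  then have "AE x in M. \<bar>f x + g x\<bar> \<le> C + D" by eventually_elim auto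
  then show ?thesis using assms by (auto simp: ess_bounded_iff)
qed

lemma ess_bounded_scale:
  assumes "f \<in> ess_bounded M"
  shows "(\<lambda>x. c * f x) \<in> ess_bounded M"
proof -
  from assms obtain C where "AE x in M. \<bar>f x\<bar> \<le> C" by (auto simp: ess_bounded_iff)
  then have "AE x in M. \<bar>c * f x\<bar> \<le> \<bar>c\<bar> * C"
    by eventually_elim (auto simp: abs_mult intro: mult_left_mono)
  then show ?thesis using assms by (auto simp: ess_bounded_iff)
qed

lemma Linf_add_class:
  assumes "f \<in> ess_bounded M" "g \<in> ess_bounded M"
  shows "nadd (Linf M) (ae_rel M `` {f}) (ae_rel M `` {g}) = ae_rel M `` {\<lambda>x. f x + g x}"
proof -
  have "congruent2 (ae_rel M) (ae_rel M) (\<lambda>f g. ae_rel M `` {\<lambda>x. f x + g x})"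
    by (rule congruent2I', rule equiv_class_eq[OF equiv_ae_rel])
      (auto simp: ae_rel_def ess_bounded_add)
  then show ?thesis
    using UN_equiv_class2[OF equiv_ae_rel equiv_ae_rel _ assms] by (simp add: Linf_def)
qed

lemma Linf_scale_class:
  assumes "f \<in> ess_bounded M"
  shows "nscale (Linf M) c (ae_rel M `` {f}) = ae_rel M `` {\<lambda>x. c * f x}"
proof -
  have "congruent (ae_rel M) (\<lambda>f. ae_rel M `` {\<lambda>x. c * f x})"
    by (rule congruentI, rule equiv_class_eq[OF equiv_ae_rel])
      (auto simp: ae_rel_def ess_bounded_scale)
  then show ?thesis
    using UN_equiv_class[OF equiv_ae_rel _ assms] by (simp add: Linf_def)
qed

lemma Linf_norm_class:
  assumes "f \<in> ess_bounded M"
  shows "nnorm (Linf M) (ae_rel M `` {f}) = enn2real (ess_norm M f)"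
proof -
  have "enn2real (ess_norm M g) = enn2real (ess_norm M f)" if "g \<in> ae_rel M `` {f}" for g
    using that unfolding ess_norm_def
    by (intro arg_cong[where f = enn2real] esssup_AE_cong) (auto simp: ae_rel_def ess_bounded_def)
  then have "(\<lambda>g. enn2real (ess_norm M g)) ` (ae_rel M `` {f})
      = (\<lambda>g. enn2real (ess_norm M f)) ` (ae_rel M `` {f})"
    by (rule image_cong[OF refl])
  moreover have "ae_rel M `` {f} \<noteq> {}"
    using equiv_class_self[OF equiv_ae_rel assms] by blast
  ultimately show ?thesis by (simp add: Linf_def image_constant_conv)
qed

end

theory Submission
  imports Defs
begin

text \<open>
  For compact operators, being range strongly exposing means that the closure of the image of the unit
  ball touches the sphere of radius the operator norm only at one pair of opposite points, and that
  this pair is attained.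

  Let the range be uniformly convex and let a compact operator \<open>T\<close> of norm one almost attain its norm
  at \<open>x\<close>. Two convexity arguments are used, both of the form "a segment in the unit ball whose
  midpoint is almost of norm one is short" (\<open>uniformly_convex_midpoint\<close>). The first shows that \<open>T\<close>
  almost vanishes on functions supported where \<open>\<bar>x\<bar>\<close> is not close to one; so \<open>T\<close> may be cut off to the
  rest, and \<open>x\<close> may be replaced there by its sign. The second shows that \<open>T\<close>, after a small rank-one
  perturbation, hardly changes when its argument is multiplied by a function that takes the new point
  \<open>x0\<close> to an almost maximizing \<open>u\<close>. As \<open>u\<close> runs through a maximizing sequence, the modified operators
  accumulate, by compactness, at an operator that attains its norm at \<open>x0\<close> itself
  (\<open>norm_attaining_approximation\<close>). A last rank-one perturbation, built from a functional that norms
  the image of \<open>x0\<close>, destroys all other directions in which the norm is approached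
  (\<open>strongly_exposing_perturbation\<close>).

  Conversely, if the range is not uniformly convex, two unit vectors that are far apart but
  have a midpoint almost of norm one give an operator, factoring through the plane with the maximum
  norm, that almost attains its norm at the indicator of a set \<open>A\<close>. Every operator that attains its
  norm near this indicator attains it along a whole segment in the direction of the complement of
  \<open>A\<close>, which is incompatible with being range strongly exposing unless the operator vanishes in that
  direction; but then it is far from the given one
  (\<open>uniformly_convex_of_BPBp_RSE\<close>). The dimension of the domain provides the set \<open>A\<close>; the functionals
  needed on arbitrary measure spaces come from \<open>mean_on\<close>.
\<close>

section \<open>Simultaneous limits along a finer filter\<close>

text \<open>
  Tychonoff's theorem in the form of a generalised limit: the finer filter \<open>G\<close> plays the role of an
  ultrafilter for the given family. It is used twice, to define a limit operator along a maximizing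
  sequence and to build positive functionals on essentially bounded functions out of point
  evaluations.
\<close>

lemma simultaneous_limits:
  fixes k :: "'i \<Rightarrow> 'p \<Rightarrow> 'y::topological_space"
  assumes "F \<noteq> bot"
    and compact: "\<And>p. p \<in> P \<Longrightarrow> compact (C p)"
    and ev: "\<And>p. p \<in> P \<Longrightarrow> eventually (\<lambda>i. k i p \<in> C p) F"
  obtains G l where "G \<le> F" "G \<noteq> bot"
    "\<And>p. p \<in> P \<Longrightarrow> ((\<lambda>i. k i p) \<longlongrightarrow> l p) G"
proof -
  \<comment> \<open>Each coordinate lies in \<open>C p\<close> only eventually, and not uniformly in \<open>p\<close>. Redirecting the
    exceptional values into \<open>D p\<close> puts every \<open>k' i\<close> into one compact product without changing
    any coordinate limit.\<close>
  define D where "D p = (if p \<in> P then C p else {undefined})" for p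
  define k' where "k' i p = (if p \<in> P \<and> k i p \<in> C p then k i p else (SOME y. y \<in> D p))" for i p
  have "D p \<noteq> {}" for p
    using eventually_happens'[OF \<open>F \<noteq> bot\<close> ev] by (auto simp: D_def)
  then have in_D: "(SOME y. y \<in> D p) \<in> D p" for p
    by (simp add: some_in_eq)
  have k'_in: "k' i \<in> PiE UNIV D" for i
    using in_D by (auto simp: k'_def) (auto simp: D_def)
  have "compact (D p)" for p using compact by (simp add: D_def)
  then have "compact (PiE UNIV D)"
    using compactin_PiE[of "\<lambda>p. euclidean" UNIV D] by (simp add: euclidean_product_topology)
  moreover have "filtermap k' F \<noteq> bot"
    using \<open>F \<noteq> bot\<close> by (simp add: filtermap_bot_iff)
  moreover have "eventually (\<lambda>x. x \<in> PiE UNIV D) (filtermap k' F)"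
    using k'_in by (simp add: eventually_filtermap)
  ultimately obtain l where l: "l \<in> PiE UNIV D" "inf (nhds l) (filtermap k' F) \<noteq> bot"
    unfolding compact_filter by blast
  define G where "G = inf F (filtercomap k' (nhds l))"
  have "G \<noteq> bot"
  proof
    assume "G = bot"
    then have "eventually (\<lambda>_. False) (inf F (filtercomap k' (nhds l)))"
      by (simp add: G_def)
    then obtain Q R where QR: "eventually Q F" "eventually R (filtercomap k' (nhds l))"
      and no: "\<And>i. Q i \<Longrightarrow> R i \<Longrightarrow> False"
      by (auto simp: eventually_inf)
    obtain R' where R': "eventually R' (nhds l)" "\<And>i. R' (k' i) \<Longrightarrow> R i"
      using QR(2) by (auto simp: eventually_filtercomap)
    have "eventually (\<lambda>f. \<not> R' f) (filtermap k' F)"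
      unfolding eventually_filtermap using QR(1)
      by (rule eventually_mono) (use no R' in blast)
    then have "eventually (\<lambda>_. False) (inf (nhds l) (filtermap k' F))"
      unfolding eventually_inf using R'(1) by blast
    then show False using l(2) by (simp add: eventually_False)
  qed
  have "filterlim k' (nhds l) (filtercomap k' (nhds l))" by (rule filterlim_filtercomap)
  then have lim: "filterlim k' (nhds l) G"
    by (rule filterlim_mono) (auto simp: G_def)
  show thesis
  proof
    show "G \<le> F" by (simp add: G_def)
    show "G \<noteq> bot" by fact
    fix p assume p: "p \<in> P"
    have "((\<lambda>i. k' i p) \<longlongrightarrow> l p) G"
    proof (rule topological_tendstoI)
      fix S :: "'y set" assume S: "open S" "l p \<in> S"
      have "open ((\<lambda>f::'p \<Rightarrow> 'y. f p) -` S)"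
        using S(1) by (intro open_vimage continuous_on_product_coordinates)
      then have "eventually (\<lambda>f. f \<in> (\<lambda>f::'p \<Rightarrow> 'y. f p) -` S) (nhds l)"
        using S(2) by (intro eventually_nhds_in_open) auto
      then show "eventually (\<lambda>i. k' i p \<in> S) G"
        using lim by (auto simp: filterlim_iff)
    qed
    moreover have "eventually (\<lambda>i. k' i p = k i p) G"
      using filter_leD[OF \<open>G \<le> F\<close> ev[OF p]] by (rule eventually_mono) (simp add: k'_def p)
    ultimately show "((\<lambda>i. k i p) \<longlongrightarrow> l p) G"
      by (rule Lim_transform_eventually)
  qed
qed

section \<open>Norming functionals\<close>

definition sublinear :: "('y::real_vector \<Rightarrow> real) \<Rightarrow> bool" where
  "sublinear p \<longleftrightarrow> (\<forall>x y. p (x + y) \<le> p x + p y) \<and> (\<forall>c>0. \<forall>x. p (c *\<^sub>R x) = c * p x)"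

lemma sublinear_zero: "sublinear p \<Longrightarrow> p 0 = 0"
proof -
  assume "sublinear p"
  then have "p (2 *\<^sub>R 0) = 2 * p 0" unfolding sublinear_def by (metis zero_less_numeral)
  then show ?thesis by simp
qed

lemma sublinear_lower: "sublinear p \<Longrightarrow> - p (- y) \<le> p y"
proof -
  assume s: "sublinear p"
  have "p (y + (- y)) \<le> p y + p (- y)" using s unfolding sublinear_def by blast
  then show ?thesis using sublinear_zero[OF s] by simp
qed

text \<open>
  The largest sublinear function below \<open>p\<close> whose value at \<open>- z\<close> is at most \<open>- p z\<close>. If \<open>p\<close> is minimal
  then \<open>tilt p z = p\<close>, and this forces \<open>p\<close> to be additive; tilting the norm at \<open>y0\<close> forces every
  linear function below it to norm \<open>y0\<close>.
\<close>

definition tilt :: "('y::real_vector \<Rightarrow> real) \<Rightarrow> 'y \<Rightarrow> 'y \<Rightarrow> real" where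
  "tilt p z y = (INF t\<in>{0..}. p (y + t *\<^sub>R z) - t * p z)"

lemma tilt_le:
  assumes p: "sublinear p" and "t \<ge> 0"
  shows "tilt p z y \<le> p (y + t *\<^sub>R z) - t * p z"
proof -
  have "- p (- y) \<le> p (y + t *\<^sub>R z) - t * p z" if "t \<ge> 0" for t
  proof -
    have "p ((y + t *\<^sub>R z) + (- y)) \<le> p (y + t *\<^sub>R z) + p (- y)"
      using p unfolding sublinear_def by blast
    moreover have "p (t *\<^sub>R z) = t * p z"
      using p that sublinear_zero[OF p] unfolding sublinear_def by (cases "t = 0") auto
    ultimately show ?thesis by simp
  qed
  then show ?thesis
    unfolding tilt_def using \<open>t \<ge> 0\<close> by (intro cINF_lower) (auto intro!: bdd_belowI2)
qed

lemma tilt_sublinear: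
  assumes p: "sublinear p"
  shows "sublinear (tilt p z)"
proof -
  have sub: "p (x + y) \<le> p x + p y" for x y using p by (auto simp: sublinear_def)
  have greatest: "b \<le> tilt p z y" if "\<And>t. t \<ge> 0 \<Longrightarrow> b \<le> p (y + t *\<^sub>R z) - t * p z" for b y
    unfolding tilt_def using that by (intro cINF_greatest) auto
  have "tilt p z (x + y) \<le> tilt p z x + tilt p z y" for x y
  proof -
    have "tilt p z (x + y) - (p (y + s *\<^sub>R z) - s * p z) \<le> tilt p z x" if "s \<ge> 0" for s
    proof (rule greatest)
      fix t :: real assume "t \<ge> 0"
      have "tilt p z (x + y) \<le> p ((x + y) + (t + s) *\<^sub>R z) - (t + s) * p z"
        using \<open>t \<ge> 0\<close> \<open>s \<ge> 0\<close> by (intro tilt_le[OF p]) simp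
      also have "(x + y) + (t + s) *\<^sub>R z = (x + t *\<^sub>R z) + (y + s *\<^sub>R z)"
        by (simp add: algebra_simps)
      finally show "tilt p z (x + y) - (p (y + s *\<^sub>R z) - s * p z)
          \<le> p (x + t *\<^sub>R z) - t * p z"
        using sub[of "x + t *\<^sub>R z" "y + s *\<^sub>R z"] by (simp add: algebra_simps)
    qed
    then have "tilt p z (x + y) - tilt p z x \<le> tilt p z y"
      by (intro greatest) (smt (verit))
    then show ?thesis by simp
  qed
  moreover have hom: "tilt p z (c *\<^sub>R x) \<le> c * tilt p z x" if "c > 0" for c x
  proof -
    have "tilt p z (c *\<^sub>R x) / c \<le> tilt p z x"
    proof (rule greatest)
      fix t :: real assume "t \<ge> 0"
      have "tilt p z (c *\<^sub>R x) \<le> p (c *\<^sub>R x + (c * t) *\<^sub>R z) - (c * t) * p z"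
        using \<open>t \<ge> 0\<close> that by (intro tilt_le[OF p]) simp
      also have "c *\<^sub>R x + (c * t) *\<^sub>R z = c *\<^sub>R (x + t *\<^sub>R z)" by (simp add: algebra_simps)
      also have "p \<dots> = c * p (x + t *\<^sub>R z)" using p that by (auto simp: sublinear_def)
      finally show "tilt p z (c *\<^sub>R x) / c \<le> p (x + t *\<^sub>R z) - t * p z"
        using that by (simp add: field_simps)
    qed
    then show ?thesis using that by (simp add: field_simps)
  qed
  moreover have "c * tilt p z x \<le> tilt p z (c *\<^sub>R x)" if "c > 0" for c x
    using hom[of "inverse c" "c *\<^sub>R x"] that by (simp add: field_simps)
  ultimately show ?thesis unfolding sublinear_def by (meson order_antisym)
qed

text \<open>
  Zorn's lemma applies because the pointwise infimum of a chain is again sublinear: for two members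
  of the chain the smaller one can be used at both arguments. The infimum is finite since every
  sublinear function below \<open>q\<close> is bounded below by \<open>- q (- y)\<close>.
\<close>

lemma minimal_sublinear_below:
  assumes q: "sublinear q"
  obtains m where "sublinear m" "\<And>y. m y \<le> q y"
    "\<And>p. sublinear p \<Longrightarrow> (\<And>y. p y \<le> m y) \<Longrightarrow> p = m"
proof -
  define A where "A = {p. sublinear p \<and> p \<le> q}"
  let ?R = "\<lambda>p p'. p' \<le> (p :: 'a \<Rightarrow> real)"
  have "\<exists>m\<in>A. \<forall>p\<in>A. ?R m p \<longrightarrow> p = m"
  proof (rule predicate_Zorn)
    show "partial_order_on A (relation_of ?R A)"
      by (rule partial_order_on_relation_ofI) auto
  next
    fix C assume "C \<in> Chains (relation_of ?R A)"
    then have chain: "\<And>p p'. p \<in> C \<Longrightarrow> p' \<in> C \<Longrightarrow> p \<le> p' \<or> p' \<le> p" and "C \<subseteq> A"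
      unfolding Chains_def relation_of_def by auto
    show "\<exists>u\<in>A. \<forall>p\<in>C. ?R p u"
    proof (cases "C = {}")
      case True
      then show ?thesis using q by (auto simp: A_def)
    next
      case False
      define u where "u y = (INF p\<in>C. p y)" for y
      have sl: "sublinear p" "p y \<le> q y" if "p \<in> C" for p y
        using that \<open>C \<subseteq> A\<close> by (auto simp: A_def le_fun_def)
      have "- q (- y) \<le> p y" if "p \<in> C" for p y
        using sublinear_lower[OF sl(1)[OF that], of y] sl(2)[OF that, of "- y"] by linarith
      then have lower: "u y \<le> p y" if "p \<in> C" for p y
        unfolding u_def using that by (intro cINF_lower) (auto intro!: bdd_belowI2)
      have greatest: "b \<le> u y" if "\<And>p. p \<in> C \<Longrightarrow> b \<le> p y" for b y
        unfolding u_def using that False by (intro cINF_greatest) auto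
      have "u (x + y) \<le> u x + u y" for x y
      proof -
        have *: "u (x + y) \<le> p x + p' y" if "p \<in> C" "p' \<in> C" for p p'
        proof -
          from that obtain r where "r \<in> C" "r \<le> p" "r \<le> p'"
            using chain[of p p'] by (cases "p \<le> p'") auto
          then show ?thesis
            using lower[of r "x + y"] sl(1)[of r] unfolding sublinear_def le_fun_def
            by (smt (verit))
        qed
        have "u (x + y) - p' y \<le> u x" if "p' \<in> C" for p'
          by (rule greatest) (use *[OF _ that] in \<open>simp add: algebra_simps\<close>)
        then have "u (x + y) - u x \<le> u y" by (intro greatest) (smt (verit))
        then show ?thesis by simp
      qed
      moreover have hom: "u (c *\<^sub>R x) \<le> c * u x" if "c > 0" for c x
      proof -
        have "u (c *\<^sub>R x) / c \<le> u x"
        proof (rule greatest)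
          fix p assume "p \<in> C"
          then have "u (c *\<^sub>R x) \<le> c * p x"
            using lower[of p "c *\<^sub>R x"] sl(1)[of p] that by (auto simp: sublinear_def)
          then show "u (c *\<^sub>R x) / c \<le> p x" using that by (simp add: field_simps)
        qed
        then show ?thesis using that by (simp add: field_simps)
      qed
      moreover have "c * u x \<le> u (c *\<^sub>R x)" if "c > 0" for c x
        using hom[of "inverse c" "c *\<^sub>R x"] that by (simp add: field_simps)
      ultimately have "sublinear u" unfolding sublinear_def by (meson order_antisym)
      moreover have "u \<le> q"
        using False lower sl(2) by (metis ex_in_conv le_funI order_trans)
      ultimately show ?thesis using lower by (auto simp: A_def le_fun_def)
    qed
  qed
  then obtain m where "m \<in> A" and min: "\<And>p. p \<in> A \<Longrightarrow> p \<le> m \<Longrightarrow> p = m" by blast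
  show thesis
  proof
    show "sublinear m" "m y \<le> q y" for y using \<open>m \<in> A\<close> by (auto simp: A_def le_fun_def)
    fix p assume "sublinear p" "\<And>y. p y \<le> m y"
    then have "p \<le> m" by (simp add: le_fun_def)
    then show "p = m" using \<open>sublinear p\<close> \<open>m \<in> A\<close> by (intro min) (auto simp: A_def)
  qed
qed

text \<open>
  The Hahn--Banach theorem for a single vector, obtained from a minimal sublinear function below the
  tilted norm.
\<close>

lemma norming_functional:
  fixes y0 :: "'y::real_normed_vector"
  obtains f :: "'y \<Rightarrow> real" where "linear f" "\<And>y. \<bar>f y\<bar> \<le> norm y" "f y0 = norm y0"
proof -
  have norm: "sublinear (norm :: 'y \<Rightarrow> real)"
    by (auto simp: sublinear_def norm_triangle_ineq)
  from minimal_sublinear_below[OF tilt_sublinear[OF norm]] obtain f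
    where f: "sublinear f" and le: "\<And>y. f y \<le> tilt norm y0 y"
      and min: "\<And>p. sublinear p \<Longrightarrow> (\<And>y. p y \<le> f y) \<Longrightarrow> p = f" by blast
  have sup: "f y + f z \<le> f (y + z)" for y z
  proof -
    have "tilt f z = f"
      using tilt_le[OF f, of 0 z] by (intro min tilt_sublinear[OF f]) simp
    then show ?thesis using tilt_le[OF f, of 1 z y] by simp
  qed
  have add: "f (y + z) = f y + f z" for y z
    using sup[of y z] f by (force simp: sublinear_def intro: order_antisym)
  have minus: "f (- y) = - f y" for y
    using add[of y "- y"] sublinear_zero[OF f] by simp
  have "f (c *\<^sub>R y) = c * f y" for c y
  proof (cases c "0::real" rule: linorder_cases)
    case less
    then have "f ((- c) *\<^sub>R y) = - c * f y" using f by (simp add: sublinear_def del: scaleR_minus_left)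
    then show ?thesis using minus[of "c *\<^sub>R y"] by simp
  qed (use f sublinear_zero[OF f] in \<open>auto simp: sublinear_def\<close>)
  then have "linear f" using add by (intro linearI) auto
  moreover have le_norm: "f y \<le> norm y" for y
    using le[of y] tilt_le[OF norm, of 0 y0 y] by simp
  then have abs: "\<bar>f y\<bar> \<le> norm y" for y
    using le_norm[of y] le_norm[of "- y"] by (simp add: minus abs_le_iff)
  moreover have "f (- y0) \<le> - norm y0"
    using le[of "- y0"] tilt_le[OF norm, of 1 y0 "- y0"] by simp
  then have "f y0 = norm y0" using le_norm[of y0] by (simp add: minus)
  ultimately show thesis using that by blast
qed

section \<open>Uniform convexity and rank-one perturbations\<close>

text \<open>
  The form in which uniform convexity is used throughout: a segment \<open>[a - b, a + b]\<close> inside the unit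
  ball whose midpoint is almost of norm one is short. The endpoints are then almost of norm one, and
  normalizing them costs a small multiple of \<open>\<gamma>\<close>.
\<close>

lemma uniformly_convex_midpoint:
  assumes uc: "uniformly_convex TYPE('y::real_normed_vector)" and "\<kappa> > 0"
  obtains \<gamma> where "\<gamma> > 0"
    "\<And>a b :: 'y. norm (a + b) \<le> 1 \<Longrightarrow> norm (a - b) \<le> 1 \<Longrightarrow> norm a > 1 - \<gamma> \<Longrightarrow> norm b < \<kappa>"
proof -
  from uc \<open>\<kappa> > 0\<close> obtain \<delta> where "0 < \<delta>" and \<delta>:
    "\<And>y1 y2 :: 'y. norm y1 = 1 \<Longrightarrow> norm y2 = 1 \<Longrightarrow> norm (y1 + y2) / 2 > 1 - \<delta> \<Longrightarrow>
      norm (y1 - y2) < \<kappa>"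
    by (force simp: uniformly_convex_def)
  define \<gamma> where "\<gamma> = min (1/4) (min (\<delta> / 3) (\<kappa> / 4))"
  have \<gamma>: "\<gamma> > 0" "\<gamma> \<le> 1/4" "3 * \<gamma> \<le> \<delta>" "4 * \<gamma> \<le> \<kappa>"
    unfolding \<gamma>_def using \<open>0 < \<delta>\<close> \<open>\<kappa> > 0\<close> by linarith+
  show thesis
  proof
    show "\<gamma> > 0" by fact
    fix a b :: 'y
    assume ab: "norm (a + b) \<le> 1" "norm (a - b) \<le> 1" "norm a > 1 - \<gamma>"
    have two: "norm ((a + b) + (a - b)) = 2 * norm a"
      by (simp flip: scaleR_2)
    have n: "norm (a + b) > 1 - 2 * \<gamma>" "norm (a - b) > 1 - 2 * \<gamma>"
      using norm_triangle_ineq[of "a + b" "a - b"] ab two by linarith+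
    have near: "norm (sgn y - y) < 2 * \<gamma>" "norm (sgn y) = 1"
      if "norm y \<le> 1" "norm y > 1 - 2 * \<gamma>" for y :: 'y
    proof -
      have "y \<noteq> 0" using that \<gamma> by auto
      then have "sgn y - y = (1 - norm y) *\<^sub>R sgn y"
        by (simp add: sgn_div_norm algebra_simps)
      then show "norm (sgn y - y) < 2 * \<gamma>" "norm (sgn y) = 1"
        using that \<open>y \<noteq> 0\<close> by (auto simp: norm_sgn)
    qed
    let ?u = "sgn (a + b)" and ?v = "sgn (a - b)"
    have u: "norm (?u - (a + b)) < 2 * \<gamma>" "norm ?u = 1" using near[of "a + b"] ab n by auto
    have v: "norm (?v - (a - b)) < 2 * \<gamma>" "norm ?v = 1" using near[of "a - b"] ab n by auto
    have "norm ((a + b) + (a - b)) \<le> norm (?u + ?v) + norm (?u - (a + b)) + norm (?v - (a - b))"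
      by norm
    then have "norm (?u + ?v) / 2 > 1 - \<delta>" using u v two ab \<gamma> by linarith
    then have "norm (?u - ?v) < \<kappa>" using \<delta> u v by blast
    moreover have "norm ((a + b) - (a - b)) \<le> norm (?u - ?v) + norm (?u - (a + b)) + norm (?v - (a - b))"
      by norm
    moreover have "norm ((a + b) - (a - b)) = 2 * norm b"
      by (simp flip: scaleR_2)
    ultimately show "norm b < \<kappa>" using u v \<gamma> by linarith
  qed
qed

text \<open>
  The identity plus \<open>\<delta>\<close> times the rank-one operator \<open>f\<close> tensor \<open>y0\<close>, scaled to remain a contraction.
  Composing an operator with it favours the direction \<open>y0\<close>: a vector of the unit ball stays almost
  of norm one only if \<open>f\<close> is almost of modulus one there.
\<close>

definition push :: "real \<Rightarrow> ('y \<Rightarrow> real) \<Rightarrow> 'y \<Rightarrow> 'y \<Rightarrow> 'y::real_normed_vector" where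
  "push \<delta> f y0 y = (y + (\<delta> * f y) *\<^sub>R y0) /\<^sub>R (1 + \<delta>)"

lemma
  fixes f :: "'y::real_normed_vector \<Rightarrow> real"
  assumes f: "linear f" "\<And>y. \<bar>f y\<bar> \<le> norm y" and y0: "norm y0 = 1" "f y0 = 1" and "\<delta> > 0"
  shows linear_push: "linear (push \<delta> f y0)"
    and push_fixes: "push \<delta> f y0 y0 = y0"
    and functional_push: "f (push \<delta> f y0 y) = f y"
    and norm_push_le: "norm (push \<delta> f y0 y) \<le> norm y"
    and push_near: "norm y \<le> 1 \<Longrightarrow> norm (push \<delta> f y0 y - y) \<le> 2 * \<delta>"
    and push_norm_bound: "(1 + \<delta>) * norm (push \<delta> f y0 y) \<le> norm y + \<delta> * \<bar>f y\<bar>"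
    and continuous_push: "continuous_on A (push \<delta> f y0)"
proof -
  interpret linear f by fact
  show lin: "linear (push \<delta> f y0)"
    unfolding push_def by (rule linearI) (simp_all add: add scale algebra_simps)
  have "y0 + \<delta> *\<^sub>R y0 = (1 + \<delta>) *\<^sub>R y0" by (simp add: algebra_simps)
  then show "push \<delta> f y0 y0 = y0" using y0 \<open>\<delta> > 0\<close> by (simp add: push_def)
  have "f (push \<delta> f y0 y) = inverse (1 + \<delta>) * ((1 + \<delta>) * f y)"
    using y0 by (simp add: push_def add scale algebra_simps)
  then show "f (push \<delta> f y0 y) = f y"
    using \<open>\<delta> > 0\<close> by simp
  have "(1 + \<delta>) * norm (push \<delta> f y0 y) = norm (y + (\<delta> * f y) *\<^sub>R y0)" for y
    using \<open>\<delta> > 0\<close> by (simp add: push_def)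
  also have "\<dots> y \<le> norm y + \<delta> * \<bar>f y\<bar>" for y
    using norm_triangle_ineq[of y "(\<delta> * f y) *\<^sub>R y0"] y0 \<open>\<delta> > 0\<close> by (simp add: abs_mult)
  finally have bound: "(1 + \<delta>) * norm (push \<delta> f y0 y) \<le> norm y + \<delta> * \<bar>f y\<bar>" for y .
  then show "(1 + \<delta>) * norm (push \<delta> f y0 y) \<le> norm y + \<delta> * \<bar>f y\<bar>" .
  have "(1 + \<delta>) * norm (push \<delta> f y0 y) \<le> (1 + \<delta>) * norm y" for y
    using order_trans[OF bound[of y] add_left_mono[OF mult_left_mono[OF f(2)[of y], of \<delta>]]] \<open>\<delta> > 0\<close>
    by (simp add: algebra_simps)
  then show le: "norm (push \<delta> f y0 y) \<le> norm y" for y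
    using \<open>\<delta> > 0\<close> by (simp add: mult_le_cancel_left)
  have eq: "push \<delta> f y0 y - y = \<delta> *\<^sub>R (f y *\<^sub>R y0 - push \<delta> f y0 y)"
  proof -
    have "(1 + \<delta>) *\<^sub>R push \<delta> f y0 y = y + (\<delta> * f y) *\<^sub>R y0"
      using \<open>\<delta> > 0\<close> by (simp add: push_def)
    then show ?thesis by (simp add: algebra_simps)
  qed
  show "norm (push \<delta> f y0 y - y) \<le> 2 * \<delta>" if "norm y \<le> 1"
  proof -
    have "norm (f y *\<^sub>R y0 - push \<delta> f y0 y) \<le> 2"
      using norm_triangle_ineq4[of "f y *\<^sub>R y0" "push \<delta> f y0 y"] f(2)[of y] le[of y] y0 that by simp
    then show ?thesis unfolding eq using \<open>\<delta> > 0\<close> by simp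
  qed
  have "bounded_linear (push \<delta> f y0)"
    by (rule linear_bounded_pos[THEN iffD2] bounded_linear_intro[of _ 1])
      (auto simp: le linear_add[OF lin] linear_scale[OF lin])
  then show "continuous_on A (push \<delta> f y0)"
    by (rule linear_continuous_on)
qed

section \<open>The unit ball of essentially bounded functions\<close>

abbreviation cls :: "'a measure \<Rightarrow> ('a \<Rightarrow> real) \<Rightarrow> ('a \<Rightarrow> real) set" where
  "cls M f \<equiv> ae_rel M `` {f}"

definition ess_ball :: "'a measure \<Rightarrow> ('a \<Rightarrow> real) set" where
  "ess_ball M = {f \<in> borel_measurable M. AE x in M. \<bar>f x\<bar> \<le> 1}"

lemma ess_ballI: "f \<in> borel_measurable M \<Longrightarrow> AE x in M. \<bar>f x\<bar> \<le> 1 \<Longrightarrow> f \<in> ess_ball M"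
  by (simp add: ess_ball_def)

lemma ess_ballD:
  assumes "f \<in> ess_ball M"
  shows "f \<in> borel_measurable M" "AE x in M. \<bar>f x\<bar> \<le> 1" "f \<in> ess_bounded M"
  using assms by (auto simp: ess_ball_def ess_bounded_iff)

lemma const_ess_bounded: "(\<lambda>x. c) \<in> ess_bounded M"
  by (auto simp: ess_bounded_iff)

lemma zero_in_ess_ball: "(\<lambda>x. 0) \<in> ess_ball M"
  by (simp add: ess_ball_def)

lemma ess_bounded_diff:
  "f \<in> ess_bounded M \<Longrightarrow> g \<in> ess_bounded M \<Longrightarrow> (\<lambda>x. f x - g x) \<in> ess_bounded M"
  using ess_bounded_add[OF _ ess_bounded_scale, of f M g "-1"] by simp

lemma ess_bounded_mult:
  assumes "f \<in> ess_bounded M" "g \<in> ess_bounded M"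
  shows "(\<lambda>x. f x * g x) \<in> ess_bounded M"
proof -
  from assms obtain C D where "AE x in M. \<bar>f x\<bar> \<le> C" "AE x in M. \<bar>g x\<bar> \<le> D"
    by (auto simp: ess_bounded_iff)
  then have "AE x in M. \<bar>f x * g x\<bar> \<le> C * D"
    by eventually_elim (auto simp: abs_mult intro!: mult_mono)
  then show ?thesis using assms by (auto simp: ess_bounded_iff)
qed

lemma ess_ball_mult:
  assumes "f \<in> ess_ball M" "g \<in> ess_ball M"
  shows "(\<lambda>x. f x * g x) \<in> ess_ball M"
proof (rule ess_ballI)
  show "AE x in M. \<bar>f x * g x\<bar> \<le> 1"
    using ess_ballD(2)[OF assms(1)] ess_ballD(2)[OF assms(2)]
    by eventually_elim (auto simp: abs_mult intro!: mult_le_one)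
qed (use assms in \<open>auto simp: ess_ball_def\<close>)

lemma ess_ball_minus: "f \<in> ess_ball M \<Longrightarrow> (\<lambda>x. - f x) \<in> ess_ball M"
  by (auto simp: ess_ball_def)

lemma indicator_in_ess_ball: "A \<in> sets M \<Longrightarrow> indicat_real A \<in> ess_ball M"
  by (rule ess_ballI) (auto simp: indicator_def)

lemma carr_Linf: "carr (Linf M) = cls M ` ess_bounded M"
  by (auto simp: Linf_def quotient_def)

lemma cls_eq_iff:
  "f \<in> ess_bounded M \<Longrightarrow> g \<in> ess_bounded M \<Longrightarrow> cls M f = cls M g \<longleftrightarrow> (AE x in M. f x = g x)"
  using eq_equiv_class_iff[OF equiv_ae_rel, of f M g] by (simp add: ae_rel_def)

lemma Linf_norm_le_iff:
  assumes f: "f \<in> ess_bounded M" and "c \<ge> 0"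
  shows "nnorm (Linf M) (cls M f) \<le> c \<longleftrightarrow> (AE x in M. \<bar>f x\<bar> \<le> c)"
proof -
  have m: "(\<lambda>x. ennreal \<bar>f x\<bar>) \<in> borel_measurable M" and fin: "ess_norm M f < \<infinity>"
    using f by (auto simp: ess_bounded_def)
  have "nnorm (Linf M) (cls M f) \<le> c \<longleftrightarrow> ess_norm M f \<le> ennreal c"
    unfolding Linf_norm_class[OF f] using fin \<open>c \<ge> 0\<close>
    by (metis enn2real_leI ennreal_enn2real ennreal_leI infinity_ennreal_def)
  also have "\<dots> \<longleftrightarrow> (AE x in M. ennreal \<bar>f x\<bar> \<le> ennreal c)"
  proof
    assume "ess_norm M f \<le> ennreal c"
    then show "AE x in M. ennreal \<bar>f x\<bar> \<le> ennreal c"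
      using esssup_AE[of "\<lambda>x. ennreal \<bar>f x\<bar>" M]
      unfolding ess_norm_def by (auto elim: eventually_mono intro: order_trans)
  qed (use m in \<open>auto simp: ess_norm_def\<close>)
  finally show ?thesis using \<open>c \<ge> 0\<close> by simp
qed

lemma Linf_norm_nonneg: "F \<in> carr (Linf M) \<Longrightarrow> nnorm (Linf M) F \<ge> 0"
  by (auto simp: carr_Linf Linf_norm_class)

lemma unit_ball_Linf: "unit_ball (Linf M) = cls M ` ess_ball M"
proof -
  have "cls M f \<in> unit_ball (Linf M) \<longleftrightarrow> f \<in> ess_ball M" if "f \<in> ess_bounded M" for f
    using that by (auto simp: unit_ball_def carr_Linf Linf_norm_le_iff ess_ball_def ess_bounded_def)
  then show ?thesis
    using ess_ballD(3) by (force simp: unit_ball_def carr_Linf)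
qed

lemma Linf_diff_class:
  assumes "f \<in> ess_bounded M" "g \<in> ess_bounded M"
  shows "ndiff (Linf M) (cls M f) (cls M g) = cls M (\<lambda>x. f x - g x)"
  using Linf_add_class[OF assms(1) ess_bounded_scale[OF assms(2)], of "-1"]
  by (simp add: ndiff_def Linf_scale_class[OF assms(2)])

section \<open>Linear maps on essentially bounded functions\<close>

text \<open>
  Operators on the quotient space are handled through representatives. A linear map on functions that
  is bounded on the unit ball automatically respects equality almost everywhere, because arbitrarily
  large multiples of a null function belong to the ball.
\<close>

definition lin_ess :: "'a measure \<Rightarrow> (('a \<Rightarrow> real) \<Rightarrow> 'y::real_normed_vector) \<Rightarrow> bool" where
  "lin_ess M t \<longleftrightarrow>
    (\<forall>f\<in>ess_bounded M. \<forall>g\<in>ess_bounded M. t (\<lambda>x. f x + g x) = t f + t g) \<and>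
    (\<forall>c. \<forall>f\<in>ess_bounded M. t (\<lambda>x. c * f x) = c *\<^sub>R t f)"

lemma
  assumes "lin_ess M t"
  shows lin_ess_add: "f \<in> ess_bounded M \<Longrightarrow> g \<in> ess_bounded M \<Longrightarrow> t (\<lambda>x. f x + g x) = t f + t g"
    and lin_ess_scale: "f \<in> ess_bounded M \<Longrightarrow> t (\<lambda>x. c * f x) = c *\<^sub>R t f"
    and lin_ess_minus: "f \<in> ess_bounded M \<Longrightarrow> t (\<lambda>x. - f x) = - t f"
    and lin_ess_diff: "f \<in> ess_bounded M \<Longrightarrow> g \<in> ess_bounded M \<Longrightarrow> t (\<lambda>x. f x - g x) = t f - t g"
proof -
  show add: "t (\<lambda>x. f x + g x) = t f + t g"
    if "f \<in> ess_bounded M" "g \<in> ess_bounded M" for f g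
    using assms that by (auto simp: lin_ess_def)
  show scale: "t (\<lambda>x. c * f x) = c *\<^sub>R t f" if "f \<in> ess_bounded M" for c f
    using assms that by (auto simp: lin_ess_def)
  show "t (\<lambda>x. - f x) = - t f" if "f \<in> ess_bounded M" for f
    using scale[OF that, of "-1"] by simp
  show "t (\<lambda>x. f x - g x) = t f - t g"
    if "f \<in> ess_bounded M" "g \<in> ess_bounded M" for f g
    using add[OF that(1) ess_bounded_scale[OF that(2)], of "-1"] scale[OF that(2), of "-1"] by simp
qed

lemma lin_ess_mult:
  assumes t: "lin_ess M t" and \<phi>: "\<phi> \<in> ess_bounded M"
  shows "lin_ess M (\<lambda>f. t (\<lambda>x. \<phi> x * f x))"
proof -
  have "t (\<lambda>x. \<phi> x * (c * f x)) = c *\<^sub>R t (\<lambda>x. \<phi> x * f x)" if "f \<in> ess_bounded M" for c f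
    using lin_ess_scale[OF t ess_bounded_mult[OF \<phi> that], of c] by (simp add: mult.left_commute)
  then show ?thesis
    unfolding lin_ess_def using \<phi>
    by (simp add: distrib_left lin_ess_add[OF t] ess_bounded_mult)
qed

lemma lin_ess_compose: "linear R \<Longrightarrow> lin_ess M t \<Longrightarrow> lin_ess M (\<lambda>f. R (t f))"
  by (simp add: lin_ess_def linear_add linear_scale)

lemma lin_ess_limit:
  assumes "G \<noteq> bot" and k: "\<And>i. lin_ess M (k i)"
    and lim: "\<And>f. f \<in> ess_bounded M \<Longrightarrow> ((\<lambda>i. k i f) \<longlongrightarrow> l f) G"
  shows "lin_ess M l"
  unfolding lin_ess_def
proof safe
  fix f g assume fg: "f \<in> ess_bounded M" "g \<in> ess_bounded M"
  have "((\<lambda>i. k i (\<lambda>x. f x + g x)) \<longlongrightarrow> l f + l g) G"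
    using tendsto_add[OF lim[OF fg(1)] lim[OF fg(2)]] by (simp add: lin_ess_add[OF k] fg)
  with lim[OF ess_bounded_add[OF fg]] show "l (\<lambda>x. f x + g x) = l f + l g"
    by (rule tendsto_unique[OF \<open>G \<noteq> bot\<close>])
next
  fix c f assume f: "f \<in> ess_bounded M"
  have "((\<lambda>i. k i (\<lambda>x. c * f x)) \<longlongrightarrow> c *\<^sub>R l f) G"
    using tendsto_scaleR[OF tendsto_const[of c] lim[OF f]] by (simp add: lin_ess_scale[OF k] f)
  with lim[OF ess_bounded_scale[OF f]] show "l (\<lambda>x. c * f x) = c *\<^sub>R l f"
    by (rule tendsto_unique[OF \<open>G \<noteq> bot\<close>])
qed

lemma lin_ess_bound:
  assumes t: "lin_ess M t" and B: "\<And>f. f \<in> ess_ball M \<Longrightarrow> norm (t f) \<le> B"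
    and f: "f \<in> ess_bounded M" "AE x in M. \<bar>f x\<bar> \<le> c" and "c \<ge> 0"
  shows "norm (t f) \<le> B * c"
proof -
  have pos: "norm (t f) \<le> B * d" if "d > c" for d
  proof -
    have "(\<lambda>x. inverse d * f x) \<in> ess_ball M"
    proof (rule ess_ballI)
      show "AE x in M. \<bar>inverse d * f x\<bar> \<le> 1"
        using f(2) by eventually_elim (use that \<open>c \<ge> 0\<close> in \<open>auto simp: abs_mult field_simps\<close>)
    qed (use f in \<open>auto simp: ess_bounded_def\<close>)
    then have "norm (inverse d *\<^sub>R t f) \<le> B"
      unfolding lin_ess_scale[OF t f(1), symmetric] by (rule B)
    then show ?thesis
      using that \<open>c \<ge> 0\<close> by (simp add: field_simps)
  qed
  have "((\<lambda>d. B * d) \<longlongrightarrow> B * c) (at_right c)" by (intro tendsto_intros)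
  moreover have "eventually (\<lambda>d. norm (t f) \<le> B * d) (at_right c)"
    using pos by (auto simp: eventually_at_filter)
  ultimately show ?thesis by (intro tendsto_lowerbound) auto
qed

lemma lin_ess_AE_cong:
  assumes t: "lin_ess M t" and B: "\<And>f. f \<in> ess_ball M \<Longrightarrow> norm (t f) \<le> B"
    and fg: "f \<in> ess_bounded M" "g \<in> ess_bounded M" "AE x in M. f x = g x"
  shows "t f = t g"
proof -
  have "norm (t (\<lambda>x. f x - g x)) \<le> B * 0"
    using fg(3) by (intro lin_ess_bound[OF t B ess_bounded_diff]) (auto simp: fg elim: eventually_mono)
  then show ?thesis by (simp add: lin_ess_diff[OF t] fg)
qed

section \<open>Operators on the quotient space\<close>

definition lift :: "'a measure \<Rightarrow> (('a \<Rightarrow> real) \<Rightarrow> 'y) \<Rightarrow> ('a \<Rightarrow> real) set \<Rightarrow> 'y::real_normed_vector" where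
  "lift M t F = (if F \<in> carr (Linf M) then t (SOME f. f \<in> F) else 0)"

lemma lift_cls:
  assumes t: "lin_ess M t" and B: "\<And>f. f \<in> ess_ball M \<Longrightarrow> norm (t f) \<le> B"
    and f: "f \<in> ess_bounded M"
  shows "lift M t (cls M f) = t f"
proof -
  have "f \<in> cls M f" by (rule equiv_class_self[OF equiv_ae_rel f])
  then have "(SOME g. g \<in> cls M f) \<in> cls M f" by (metis someI)
  then have g: "(SOME g. g \<in> cls M f) \<in> ess_bounded M" "AE x in M. f x = (SOME g. g \<in> cls M f) x"
    by (auto simp: ae_rel_def)
  show ?thesis
    using lin_ess_AE_cong[OF t B f g] f by (simp add: lift_def carr_Linf)
qed

lemma lift_in_bdd_ops:
  assumes t: "lin_ess M t" and B: "\<And>f. f \<in> ess_ball M \<Longrightarrow> norm (t f) \<le> B"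
  shows "lift M t \<in> bdd_ops (Linf M)"
proof -
  note lift = lift_cls[OF t B]
  have "norm (lift M t F) \<le> B * nnorm (Linf M) F" if "F \<in> carr (Linf M)" for F
  proof -
    from that obtain f where f: "f \<in> ess_bounded M" "F = cls M f" by (auto simp: carr_Linf)
    have nn: "nnorm (Linf M) (cls M f) \<ge> 0" using Linf_norm_nonneg[OF that] f by simp
    then show ?thesis
      using lin_ess_bound[OF t B f(1) _ nn] Linf_norm_le_iff[OF f(1) nn] by (simp add: lift f)
  qed
  moreover have "\<forall>F. F \<notin> carr (Linf M) \<longrightarrow> lift M t F = 0" by (simp add: lift_def)
  moreover have "lift M t (nadd (Linf M) F G) = lift M t F + lift M t G"
    if "F \<in> carr (Linf M)" "G \<in> carr (Linf M)" for F G
    using that by (auto simp: carr_Linf Linf_add_class ess_bounded_add lift lin_ess_add[OF t])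
  moreover have "lift M t (nscale (Linf M) c F) = c *\<^sub>R lift M t F"
    if "F \<in> carr (Linf M)" for c F
    using that by (auto simp: carr_Linf Linf_scale_class ess_bounded_scale lift lin_ess_scale[OF t])
  ultimately show ?thesis unfolding bdd_ops_def by blast
qed

lemma bdd_op_lin_ess: "T \<in> bdd_ops (Linf M) \<Longrightarrow> lin_ess M (\<lambda>f. T (cls M f))"
  by (auto simp: lin_ess_def bdd_ops_def carr_Linf simp flip: Linf_add_class Linf_scale_class)

lemma norm_le_op_norm:
  assumes T: "T \<in> bdd_ops (Linf M)" and f: "f \<in> ess_ball M"
  shows "norm (T (cls M f)) \<le> op_norm (Linf M) T"
proof -
  from T obtain C where C: "\<And>F. F \<in> carr (Linf M) \<Longrightarrow> norm (T F) \<le> C * nnorm (Linf M) F"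
    unfolding bdd_ops_def by blast
  have "norm (T F) \<le> \<bar>C\<bar>" if "F \<in> unit_ball (Linf M)" for F
  proof -
    have F: "F \<in> carr (Linf M)" "nnorm (Linf M) F \<le> 1" using that by (auto simp: unit_ball_def)
    have "C * nnorm (Linf M) F \<le> \<bar>C\<bar> * 1"
      using F(2) Linf_norm_nonneg[OF F(1)] by (intro mult_mono) auto
    then show ?thesis using C[OF F(1)] by simp
  qed
  then show ?thesis
    unfolding op_norm_def using f
    by (intro cSUP_upper) (auto simp: unit_ball_Linf intro!: bdd_aboveI2)
qed

lemma op_norm_le:
  assumes "\<And>f. f \<in> ess_ball M \<Longrightarrow> norm (T (cls M f)) \<le> c"
  shows "op_norm (Linf M) T \<le> c"
  unfolding op_norm_def unit_ball_Linf
  using assms zero_in_ess_ball by (intro cSUP_least) auto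

lemma compact_opsI:
  assumes "T \<in> bdd_ops X" "compact K" "T ` unit_ball X \<subseteq> K"
  shows "T \<in> compact_ops X"
proof -
  have "closure (T ` unit_ball X) \<subseteq> K"
    using assms by (intro closure_minimal compact_imp_closed)
  then have "compact (closure (T ` unit_ball X))"
    using compact_Int_closed[OF assms(2) closed_closure[of "T ` unit_ball X"]] by (simp add: Int_absorb1)
  then show ?thesis using assms(1) by (simp add: compact_ops_def)
qed

lemma bdd_ops_diff:
  assumes "S \<in> bdd_ops X" "T \<in> bdd_ops X"
  shows "(\<lambda>z. S z - T z) \<in> bdd_ops X"
proof -
  from assms(1) obtain C where "\<And>x. x \<in> carr X \<Longrightarrow> norm (S x) \<le> C * nnorm X x"
    unfolding bdd_ops_def by blast
  moreover from assms(2) obtain D where "\<And>x. x \<in> carr X \<Longrightarrow> norm (T x) \<le> D * nnorm X x"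
    unfolding bdd_ops_def by blast
  ultimately have "norm (S x - T x) \<le> (C + D) * nnorm X x" if "x \<in> carr X" for x
    using norm_triangle_ineq4[of "S x" "T x"] that by (force simp: distrib_right)
  then have "\<exists>C. \<forall>x\<in>carr X. norm (S x - T x) \<le> C * nnorm X x" by blast
  with assms show ?thesis
    unfolding bdd_ops_def by (simp add: algebra_simps)
qed

section \<open>Uniformly convex ranges\<close>

text \<open>
  The core of the direct half. Let \<open>t\<close> be almost of norm one at \<open>x\<close>.

  Let \<open>A\<close> be the set where the modulus of \<open>x\<close> is at least \<open>1 - \<beta>\<close>. Perturbing \<open>x\<close> by \<open>\<beta> g\<close> with \<open>g\<close>
  supported off \<open>A\<close> stays in the unit ball, so uniform convexity makes \<open>t\<close> small off \<open>A\<close>, and \<open>t\<close> may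
  be cut off to \<open>A\<close>. Let \<open>x0\<close> be \<open>x\<close> scaled up and truncated, so that \<open>x0\<close> has values \<open>1\<close> and \<open>-1\<close>
  on \<open>A\<close>, and let \<open>S\<close> be the cut-off operator pushed towards its value at \<open>x0\<close>.

  Take a maximizing sequence \<open>u n\<close> for \<open>S\<close>; by the push, \<open>S (u n)\<close> lies almost in the direction of
  \<open>S x0\<close>. On \<open>A\<close> the functions \<open>v = (x0 + u n) / 2\<close> and \<open>w = (1 - u n x0) / 2\<close> satisfy
  \<open>\<bar>v\<bar> + \<bar>w\<bar> = 1\<close> almost everywhere, and \<open>S v\<close> is almost of norm one. Uniform convexity therefore
  makes \<open>S (w h)\<close> small uniformly for \<open>h\<close> in the unit ball, that is, \<open>S h\<close> and \<open>S (u n x0 h)\<close> are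
  close.

  The operators \<open>h \<mapsto> S (u n x0 h)\<close> are thus close to \<open>S\<close>, have norm at most that of \<open>S\<close>, and take
  \<open>x0\<close> to \<open>S (u n)\<close>. By compactness of \<open>S\<close> they have a generalised limit, which attains the norm of
  \<open>S\<close> at \<open>x0\<close>.
\<close>

lemma norm_attaining_approximation:
  fixes M :: "'a measure"
  assumes uc: "uniformly_convex TYPE('y::real_normed_vector)" and "\<epsilon> > 0"
  shows "\<exists>\<eta>. 0 < \<eta> \<and> \<eta> < \<epsilon> \<and> (\<forall>(t :: ('a \<Rightarrow> real) \<Rightarrow> 'y) K x. lin_ess M t \<and> compact K \<and> t ` ess_ball M \<subseteq> K \<and>
      (\<forall>f\<in>ess_ball M. norm (t f) \<le> 1) \<and> x \<in> ess_ball M \<and> norm (t x) > 1 - \<eta> \<longrightarrow>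
      (\<exists>s L x0. lin_ess M s \<and> compact L \<and> s ` ess_ball M \<subseteq> L \<and>
        (\<forall>f\<in>ess_ball M. norm (s f) \<le> 1) \<and> x0 \<in> ess_ball M \<and> norm (s x0) = 1 \<and>
        (\<forall>f\<in>ess_ball M. norm (s f - t f) \<le> \<epsilon>) \<and> (AE z in M. \<bar>x z - x0 z\<bar> \<le> \<epsilon>)))"
proof -
  define \<delta> where "\<delta> = \<epsilon> / 8"
  have "\<delta> > 0" using \<open>\<epsilon> > 0\<close> by (simp add: \<delta>_def)
  obtain \<gamma>1 where "\<gamma>1 > 0" and \<gamma>1: "\<And>a b :: 'y. norm (a + b) \<le> 1 \<Longrightarrow> norm (a - b) \<le> 1 \<Longrightarrow>
      norm a > 1 - \<gamma>1 \<Longrightarrow> norm b < \<epsilon> / 8"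
    using uniformly_convex_midpoint[OF uc, of "\<epsilon> / 8"] \<open>\<epsilon> > 0\<close> by auto
  \<comment> \<open>\<open>\<alpha>\<close> bounds the total loss of norm at \<open>x0\<close>. The last bound lets the push turn norm
    \<open>1 - 2 * \<alpha>\<close> into functional value \<open>1 - \<gamma>1\<close>, the threshold of the second convexity argument.\<close>
  define \<alpha> where "\<alpha> = min (1/2) (min (\<epsilon> / 4) (\<gamma>1 * \<delta> / (2 * (1 + \<delta>))))"
  have "\<gamma>1 * \<delta> / (2 * (1 + \<delta>)) > 0" using \<open>\<gamma>1 > 0\<close> \<open>\<delta> > 0\<close> by simp
  then have \<alpha>: "\<alpha> > 0" "\<alpha> \<le> 1/2" "\<alpha> \<le> \<epsilon> / 4" "\<alpha> \<le> \<gamma>1 * \<delta> / (2 * (1 + \<delta>))"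
    unfolding \<alpha>_def using \<open>\<epsilon> > 0\<close> by linarith+
  then have \<alpha>\<gamma>: "2 * \<alpha> * (1 + \<delta>) \<le> \<gamma>1 * \<delta>"
    using \<open>\<delta> > 0\<close> by (simp add: field_simps)
  define \<beta> where "\<beta> = \<alpha> / 3"
  have \<beta>: "\<beta> > 0" "\<beta> < 1" "\<beta> \<le> \<epsilon>" using \<alpha> \<open>\<epsilon> > 0\<close> by (auto simp: \<beta>_def)
  \<comment> \<open>The perturbations off \<open>A\<close> have size \<open>\<beta>\<close>; dividing by \<open>\<beta>\<close> must leave \<open>\<alpha> / 3\<close>.\<close>
  have "\<beta> * (\<alpha> / 3) > 0" using \<alpha> \<beta> by simp
  then obtain \<gamma>2 where "\<gamma>2 > 0" and \<gamma>2: "\<And>a b :: 'y. norm (a + b) \<le> 1 \<Longrightarrow> norm (a - b) \<le> 1 \<Longrightarrow>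
      norm a > 1 - \<gamma>2 \<Longrightarrow> norm b < \<beta> * (\<alpha> / 3)"
    using uniformly_convex_midpoint[OF uc] by metis
  define \<eta> where "\<eta> = min \<gamma>2 (\<alpha> / 3)"
  have \<eta>: "0 < \<eta>" "\<eta> < \<epsilon>" "\<eta> \<le> \<gamma>2" "\<eta> \<le> \<alpha> / 3"
    unfolding \<eta>_def using \<open>\<gamma>2 > 0\<close> \<alpha> \<open>\<epsilon> > 0\<close> by linarith+
  show ?thesis
  proof (intro exI[of _ \<eta>] conjI allI impI \<eta>(1,2))
    fix t :: "('a \<Rightarrow> real) \<Rightarrow> 'y" and K x
    assume asm: "lin_ess M t \<and> compact K \<and> t ` ess_ball M \<subseteq> K \<and>
      (\<forall>f\<in>ess_ball M. norm (t f) \<le> 1) \<and> x \<in> ess_ball M \<and> norm (t x) > 1 - \<eta>"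
    then have t: "lin_ess M t" and K: "compact K" "t ` ess_ball M \<subseteq> K"
      and x: "x \<in> ess_ball M" "norm (t x) > 1 - \<eta>" by auto
    have t1: "norm (t f) \<le> 1" if "f \<in> ess_ball M" for f using asm that by blast
    note [measurable] = ess_ballD(1)[OF x(1)]
    note add = lin_ess_add[OF t] and scale = lin_ess_scale[OF t] and diff = lin_ess_diff[OF t]
    note ball = ess_ballD(3) ess_ball_mult
    define A where "A = {z \<in> space M. \<bar>x z\<bar> \<ge> 1 - \<beta>}"
    have A [measurable]: "A \<in> sets M" unfolding A_def by measurable
    define \<xi> where "\<xi> = indicat_real A"
    have \<xi>: "\<xi> \<in> ess_ball M" unfolding \<xi>_def by (rule indicator_in_ess_ball[OF A])
    have \<xi>2: "\<xi> z * \<xi> z = \<xi> z" "\<xi> z * (\<xi> z * r) = \<xi> z * r" for z r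
      by (auto simp: \<xi>_def indicator_def)
    define x0 where "x0 z = max (-1) (min 1 (x z / (1 - \<beta>)))" for z
    have x0: "x0 \<in> ess_ball M"
      by (rule ess_ballI) (auto simp: x0_def[abs_def])
    have near: "AE z in M. \<bar>x z - x0 z\<bar> \<le> \<beta>"
      using ess_ballD(2)[OF x(1)]
    proof eventually_elim
      fix z assume z: "\<bar>x z\<bar> \<le> 1"
      show "\<bar>x z - x0 z\<bar> \<le> \<beta>"
      proof (cases "\<bar>x z\<bar> \<le> 1 - \<beta>")
        case True
        then have "x0 z = x z / (1 - \<beta>)"
          using \<beta> by (auto simp: x0_def min_def max_def field_simps abs_le_iff)
        then have "x z - x0 z = - \<beta> * x0 z" using \<beta> by (simp add: field_simps)
        moreover have "\<bar>x0 z\<bar> \<le> 1" by (auto simp: x0_def)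
        ultimately show ?thesis using \<beta> by (simp add: abs_mult mult_left_le)
      next
        case False
        then have "1 - \<beta> < x z \<or> x z < - (1 - \<beta>)" by linarith
        then have "x0 z = 1 \<and> 1 - \<beta> < x z \<or> x0 z = -1 \<and> x z < - (1 - \<beta>)"
          using \<beta> by (auto simp: x0_def min_def max_def field_simps)
        then show ?thesis using z \<beta> by linarith
      qed
    qed
    have x0A: "x0 z = 1 \<or> x0 z = -1" if "z \<in> A" for z
    proof -
      have "1 - \<beta> \<le> x z \<or> x z \<le> - (1 - \<beta>)" using that by (auto simp: A_def)
      then show ?thesis using \<beta> by (auto simp: x0_def min_def max_def field_simps)
    qed
    \<comment> \<open>There is room \<open>\<beta>\<close> between \<open>\<bar>x\<bar>\<close> and \<open>1\<close> off \<open>A\<close>.\<close>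
    have off_A: "norm (t (\<lambda>z. (1 - \<xi> z) * g z)) \<le> \<alpha> / 3" if g: "g \<in> ess_ball M" for g
    proof -
      have g': "(\<lambda>z. (1 - \<xi> z) * g z) \<in> ess_bounded M"
        by (intro ess_bounded_mult ess_bounded_diff const_ess_bounded ball \<xi> g)
      have bb: "AE z in M. \<bar>x z\<bar> + \<bar>\<beta> * ((1 - \<xi> z) * g z)\<bar> \<le> 1"
        using ess_ballD(2)[OF x(1)] ess_ballD(2)[OF g] AE_space
      proof eventually_elim
        case (elim z)
        show ?case
        proof (cases "z \<in> A")
          case False
          then have "\<bar>\<beta> * ((1 - \<xi> z) * g z)\<bar> = \<beta> * \<bar>g z\<bar>" "\<bar>x z\<bar> < 1 - \<beta>"
            using elim \<beta> by (auto simp: \<xi>_def A_def abs_mult)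
          moreover have "\<beta> * \<bar>g z\<bar> \<le> \<beta>" using elim \<beta> by (simp add: mult_left_le)
          ultimately show ?thesis by linarith
        qed (use elim in \<open>simp add: \<xi>_def\<close>)
      qed
      have "(\<lambda>z. x z + \<beta> * ((1 - \<xi> z) * g z)) \<in> ess_ball M"
      proof (rule ess_ballI)
        show "AE z in M. \<bar>x z + \<beta> * ((1 - \<xi> z) * g z)\<bar> \<le> 1"
          using bb by eventually_elim linarith
      qed (use g' in \<open>auto simp: ess_bounded_def\<close>)
      moreover have "(\<lambda>z. x z - \<beta> * ((1 - \<xi> z) * g z)) \<in> ess_ball M"
      proof (rule ess_ballI)
        show "AE z in M. \<bar>x z - \<beta> * ((1 - \<xi> z) * g z)\<bar> \<le> 1"
          using bb by eventually_elim linarith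
      qed (use g' in \<open>auto simp: ess_bounded_def\<close>)
      ultimately have "norm (t x + \<beta> *\<^sub>R t (\<lambda>z. (1 - \<xi> z) * g z)) \<le> 1"
        "norm (t x - \<beta> *\<^sub>R t (\<lambda>z. (1 - \<xi> z) * g z)) \<le> 1"
        using t1 by (simp_all add: ball(1)[OF x(1)] g' ess_bounded_scale flip: add diff scale)
      then have "norm (\<beta> *\<^sub>R t (\<lambda>z. (1 - \<xi> z) * g z)) < \<beta> * (\<alpha> / 3)"
        using x(2) \<eta>(3) by (intro \<gamma>2) auto
      then show ?thesis using \<beta> by simp
    qed
    define t0 where "t0 f = t (\<lambda>z. \<xi> z * f z)" for f
    have t0: "lin_ess M t0"
      unfolding t0_def by (rule lin_ess_mult[OF t ball(1)[OF \<xi>]])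
    have t0_K: "t0 f \<in> K" and t0_le: "norm (t0 f) \<le> 1" if "f \<in> ess_ball M" for f
      using K(2) t1 ball(2)[OF \<xi> that] by (auto simp: t0_def)
    have t0_near: "norm (t f - t0 f) \<le> \<alpha> / 3" if f: "f \<in> ess_ball M" for f
    proof -
      have "t f - t0 f = t (\<lambda>z. f z - \<xi> z * f z)"
        unfolding t0_def by (intro diff[symmetric] ball \<xi> f)
      also have "(\<lambda>z. f z - \<xi> z * f z) = (\<lambda>z. (1 - \<xi> z) * f z)" by (simp add: algebra_simps)
      finally show ?thesis using off_A[OF f] by simp
    qed
    have "norm (t x - t x0) \<le> 1 * \<beta>"
      using lin_ess_bound[OF t t1 _ near] \<beta> ball(1)[OF x(1)] ball(1)[OF x0]
      by (simp add: diff ess_bounded_diff)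
    then have "norm (t x) \<le> norm (t0 x0) + \<beta> + \<alpha> / 3"
      using t0_near[OF x0] norm_triangle_ineq[of "t x - t x0" "t x0"]
        norm_triangle_ineq[of "t x0 - t0 x0" "t0 x0"] by simp
    then have t0_x0: "norm (t0 x0) > 1 - \<alpha>"
      using x(2) \<eta>(4) unfolding \<beta>_def by linarith
    define a where "a = norm (t0 x0)"
    have a: "1 - \<alpha> < a" "0 < a" "a \<le> 1"
      using t0_x0 t0_le[OF x0] \<alpha> by (auto simp: a_def)
    define y0 where "y0 = t0 x0 /\<^sub>R a"
    have y0: "norm y0 = 1" "t0 x0 = a *\<^sub>R y0" using a by (auto simp: y0_def a_def)
    obtain \<phi> :: "'y \<Rightarrow> real" where \<phi>: "linear \<phi>" "\<And>y. \<bar>\<phi> y\<bar> \<le> norm y" "\<phi> y0 = 1"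
      using norming_functional[of y0] y0 by metis
    note R_facts = \<phi>(1,2) y0(1) \<phi>(3) \<open>\<delta> > 0\<close>
    define R where "R = push \<delta> \<phi> y0"
    have R: "linear R" unfolding R_def by (rule linear_push[OF R_facts])
    define S where "S f = R (t0 f)" for f
    have S: "lin_ess M S" unfolding S_def by (rule lin_ess_compose[OF R t0])
    have S_le: "norm (S f) \<le> 1" if "f \<in> ess_ball M" for f
      using norm_push_le[OF R_facts, of "t0 f"] t0_le[OF that] by (simp add: S_def R_def)
    have S_\<xi>: "S (\<lambda>z. \<xi> z * f z) = S f" for f
      by (simp add: S_def t0_def \<xi>2)
    have \<phi>S: "\<phi> (S f) = \<phi> (t0 f)" for f
      unfolding S_def R_def by (rule functional_push[OF R_facts])
    have S_near: "norm (S f - t0 f) \<le> 2 * \<delta>" if "f \<in> ess_ball M" for f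
      using push_near[OF R_facts t0_le[OF that]] by (simp add: S_def R_def)
    define s0 where "s0 = (SUP f\<in>ess_ball M. norm (S f))"
    have S_s0: "norm (S f) \<le> s0" if "f \<in> ess_ball M" for f
      unfolding s0_def using that S_le by (intro cSUP_upper) (auto intro!: bdd_aboveI2)
    have "s0 \<le> 1"
      unfolding s0_def using S_le zero_in_ess_ball by (intro cSUP_least) auto
    have "\<phi> (S x0) = a" using linear_scale[OF \<phi>(1)] \<phi>(3) by (simp add: \<phi>S y0)
    then have "a \<le> s0" using \<phi>(2)[of "S x0"] S_s0[OF x0] by linarith
    then have s0: "1 - \<alpha> < s0" "0 < s0" using a by auto
    \<comment> \<open>A maximizing sequence; the sign is chosen so that its images point towards \<open>y0\<close> rather than
      towards \<open>- y0\<close>.\<close>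
    have "\<exists>u. u \<in> ess_ball M \<and> norm (S u) > s0 - \<alpha> / real (Suc n) \<and> \<phi> (S u) \<ge> 0" for n
    proof -
      have "s0 - \<alpha> / real (Suc n) < s0" using \<alpha> by simp
      moreover have "ess_ball M \<noteq> {}" using zero_in_ess_ball by blast
      moreover have "bdd_above ((\<lambda>f. norm (S f)) ` ess_ball M)" by (rule bdd_aboveI2[OF S_le])
      ultimately have "\<exists>u\<in>ess_ball M. s0 - \<alpha> / real (Suc n) < norm (S u)"
        using less_cSUP_iff[of "ess_ball M" "\<lambda>f. norm (S f)" "s0 - \<alpha> / real (Suc n)"]
        by (simp flip: s0_def)
      then obtain u where u: "u \<in> ess_ball M" "norm (S u) > s0 - \<alpha> / real (Suc n)" by blast
      have "S (\<lambda>z. - u z) = - S u" by (intro lin_ess_minus[OF S] ball u)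
      then show ?thesis
        using u ess_ball_minus[OF u(1)] linear_neg[OF \<phi>(1), of "S u"]
        by (cases "\<phi> (S u) \<ge> 0") (force intro: exI[of _ "\<lambda>z. - u z"])+
    qed
    then obtain u where u: "\<And>n. u n \<in> ess_ball M"
      and Su: "\<And>n. norm (S (u n)) > s0 - \<alpha> / real (Suc n)" and \<phi>Su: "\<And>n. \<phi> (S (u n)) \<ge> 0"
      by metis
    have u_lim: "(\<lambda>n. norm (S (u n))) \<longlonglongrightarrow> s0"
    proof (rule tendsto_sandwich)
      show "(\<lambda>n. s0 - \<alpha> / real (Suc n)) \<longlonglongrightarrow> s0"
        using tendsto_diff[OF tendsto_const[of s0] tendsto_mult[OF tendsto_const[of \<alpha>] LIMSEQ_inverse_real_of_nat]]
        by (simp add: divide_inverse)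
      show "eventually (\<lambda>n. s0 - \<alpha> / real (Suc n) \<le> norm (S (u n))) sequentially"
        using Su by (intro always_eventually allI less_imp_le)
    qed (use S_s0[OF u] in auto)
    have \<phi>Su_large: "\<phi> (S (u n)) > 1 - \<gamma>1" for n
    proof -
      have "\<alpha> / real (Suc n) \<le> \<alpha>" using \<alpha> by (simp add: field_simps)
      then have "norm (S (u n)) > 1 - 2 * \<alpha>" using Su[of n] s0 by linarith
      then have "(1 + \<delta>) * (1 - 2 * \<alpha>) < (1 + \<delta>) * norm (S (u n))"
        using \<open>\<delta> > 0\<close> by simp
      also have "\<dots> \<le> norm (t0 (u n)) + \<delta> * \<bar>\<phi> (t0 (u n))\<bar>"
        unfolding S_def R_def by (rule push_norm_bound[OF R_facts])
      also have "\<dots> \<le> 1 + \<delta> * \<phi> (S (u n))"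
        using t0_le[OF u[of n]] \<phi>Su[of n] by (simp add: \<phi>S)
      finally have "\<delta> * \<phi> (S (u n)) > \<delta> * (1 - \<gamma>1)"
        using \<alpha>\<gamma> by (simp add: algebra_simps)
      then show ?thesis using \<open>\<delta> > 0\<close> by simp
    qed
    have "\<alpha> \<le> \<gamma>1"
    proof -
      have "2 * \<alpha> * (1 + \<delta>) = 2 * \<alpha> + 2 * (\<alpha> * \<delta>)" by (simp add: algebra_simps)
      moreover have "\<alpha> * \<delta> > 0" using \<alpha> \<open>\<delta> > 0\<close> by simp
      ultimately have "\<alpha> * \<delta> \<le> \<gamma>1 * \<delta>" using \<alpha>\<gamma> \<alpha>(1) by linarith
      then show ?thesis using \<open>\<delta> > 0\<close> by simp
    qed
    \<comment> \<open>Since \<open>x0 * x0 = 1\<close> on \<open>A\<close> and \<open>S\<close> ignores the complement of \<open>A\<close>, the operator \<open>k n\<close> takes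
      \<open>x0\<close> to \<open>S (u n)\<close>.\<close>
    define k where "k n f = S (\<lambda>z. (u n z * x0 z) * f z)" for n f
    have k: "lin_ess M (k n)" for n
      unfolding k_def by (intro lin_ess_mult[OF S] ball u x0)
    have k_near: "norm (k n h - S h) \<le> \<epsilon> / 4" if h: "h \<in> ess_ball M" for n h
    proof -
      define v where "v z = \<xi> z * ((1/2) * (x0 z + u n z))" for z
      define w where "w z = \<xi> z * ((1/2) * (1 - u n z * x0 z))" for z
      have vw: "AE z in M. \<bar>v z\<bar> + \<bar>w z * h z\<bar> \<le> 1"
        using ess_ballD(2)[OF u[of n]] ess_ballD(2)[OF h]
      proof eventually_elim
        case (elim z)
        show ?case
        proof (cases "z \<in> A")
          case True
          have "\<bar>w z * h z\<bar> \<le> \<bar>w z\<bar>" using elim by (simp add: abs_mult mult_left_le)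
          moreover have "\<bar>v z\<bar> + \<bar>w z\<bar> \<le> 1"
            using x0A[OF True] elim True by (auto simp: v_def w_def \<xi>_def abs_if field_simps)
          ultimately show ?thesis by linarith
        qed (simp add: v_def w_def \<xi>_def)
      qed
      have v: "v \<in> ess_bounded M" unfolding v_def[abs_def]
        by (intro ess_bounded_mult ess_bounded_scale ess_bounded_add ball \<xi> x0 u)
      have w: "w \<in> ess_bounded M" unfolding w_def[abs_def]
        by (intro ess_bounded_mult ess_bounded_scale ess_bounded_diff const_ess_bounded ball \<xi> x0 u)
      have wh: "(\<lambda>z. w z * h z) \<in> ess_bounded M" by (intro ess_bounded_mult w ball h)
      have "(\<lambda>z. v z + w z * h z) \<in> ess_ball M"
        using vw ess_bounded_add[OF v wh]
        by (auto simp: ess_ball_def ess_bounded_iff elim!: eventually_mono)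
      moreover have "(\<lambda>z. v z - w z * h z) \<in> ess_ball M"
        using vw ess_bounded_diff[OF v wh]
        by (auto simp: ess_ball_def ess_bounded_iff elim!: eventually_mono)
      ultimately have "norm (S v + S (\<lambda>z. w z * h z)) \<le> 1" "norm (S v - S (\<lambda>z. w z * h z)) \<le> 1"
        using S_le by (simp_all add: v wh flip: lin_ess_add[OF S] lin_ess_diff[OF S])
      moreover have "norm (S v) > 1 - \<gamma>1"
      proof -
        have "S v = (1/2) *\<^sub>R (S x0 + S (u n))"
          unfolding v_def[abs_def] S_\<xi>
          by (simp only: lin_ess_scale[OF S] lin_ess_add[OF S] ess_bounded_add ball(1)[OF x0] ball(1)[OF u])
        then have "2 * \<phi> (S v) = a + \<phi> (S (u n))"
          using \<open>\<phi> (S x0) = a\<close> by (simp add: linear_add[OF \<phi>(1)] linear_scale[OF \<phi>(1)])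
        then show ?thesis using \<phi>(2)[of "S v"] \<phi>Su_large[of n] a \<open>\<alpha> \<le> \<gamma>1\<close> by linarith
      qed
      ultimately have small: "norm (S (\<lambda>z. w z * h z)) < \<epsilon> / 8" by (intro \<gamma>1)
      have "k n h - S h = S (\<lambda>z. (u n z * x0 z) * h z - h z)"
        unfolding k_def by (intro lin_ess_diff[OF S, symmetric] ball u x0 h)
      also have "\<dots> = S (\<lambda>z. \<xi> z * ((u n z * x0 z) * h z - h z))" by (rule S_\<xi>[symmetric])
      also have "(\<lambda>z. \<xi> z * ((u n z * x0 z) * h z - h z)) = (\<lambda>z. (- 2) * (w z * h z))"
        by (rule ext) (simp add: w_def algebra_simps)
      also have "S \<dots> = (- 2) *\<^sub>R S (\<lambda>z. w z * h z)" by (rule lin_ess_scale[OF S wh])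
      finally show ?thesis using small by simp
    qed
    define L where "L = R ` K"
    have "compact L"
      unfolding L_def R_def by (intro compact_continuous_image continuous_push[OF R_facts] K)
    have S_L: "S f \<in> L" if "f \<in> ess_ball M" for f
      using t0_K[OF that] by (simp add: S_def L_def)
    have "\<exists>c>0. AE z in M. \<bar>f z\<bar> \<le> c" if "f \<in> ess_bounded M" for f
    proof -
      from that obtain c where "AE z in M. \<bar>f z\<bar> \<le> c" by (auto simp: ess_bounded_iff)
      then have "AE z in M. \<bar>f z\<bar> \<le> max 1 c" by eventually_elim simp
      then show ?thesis by (intro exI[of _ "max 1 c"]) simp
    qed
    then obtain c where c: "\<And>f. f \<in> ess_bounded M \<Longrightarrow> c f > 0"
      "\<And>f. f \<in> ess_bounded M \<Longrightarrow> AE z in M. \<bar>f z\<bar> \<le> c f" by metis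
    have k_L: "k n f \<in> (*\<^sub>R) (c f) ` L" if f: "f \<in> ess_bounded M" for n f
    proof -
      have "(\<lambda>z. inverse (c f) * f z) \<in> ess_ball M"
      proof (rule ess_ballI)
        show "AE z in M. \<bar>inverse (c f) * f z\<bar> \<le> 1"
          using c(2)[OF f] by eventually_elim (use c(1)[OF f] in \<open>simp add: abs_mult field_simps\<close>)
      qed (use f in \<open>auto simp: ess_bounded_def\<close>)
      then have "k n (\<lambda>z. inverse (c f) * f z) \<in> L"
        unfolding k_def by (intro S_L ball(2)[OF ball(2)[OF u x0]])
      then have "inverse (c f) *\<^sub>R k n f \<in> L" by (simp add: lin_ess_scale[OF k f])
      then show ?thesis using c(1)[OF f] by (intro image_eqI[of _ _ "inverse (c f) *\<^sub>R k n f"]) auto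
    qed
    \<comment> \<open>The bound \<open>c f\<close> confines the values at \<open>f\<close> to a fixed compact set, so that the operators \<open>k n\<close>
      converge simultaneously at all functions.\<close>
    obtain G l where G: "G \<le> sequentially" "G \<noteq> bot"
      and l: "\<And>f. f \<in> ess_bounded M \<Longrightarrow> ((\<lambda>n. k n f) \<longlongrightarrow> l f) G"
      by (rule simultaneous_limits[of sequentially "ess_bounded M" "\<lambda>f. (*\<^sub>R) (c f) ` L" k])
        (use k_L \<open>compact L\<close> in \<open>auto intro!: compact_scaling always_eventually\<close>)
    have lin_l: "lin_ess M l" by (rule lin_ess_limit[OF G(2) k l])
    have l_L: "l f \<in> L" and l_le: "norm (l f) \<le> s0" and l_near: "norm (l f - S f) \<le> \<epsilon> / 4"
      if f: "f \<in> ess_ball M" for f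
    proof -
      note lim = l[OF ball(1)[OF f]]
      have kf: "k n f \<in> L" "norm (k n f) \<le> s0" for n
        unfolding k_def by (intro S_L S_s0 ball u x0 f)+
      show "l f \<in> L"
        using kf(1) by (intro Lim_in_closed_set[OF compact_imp_closed[OF \<open>compact L\<close>] _ G(2) lim]) simp
      show "norm (l f) \<le> s0"
        using kf(2) by (intro tendsto_upperbound[OF tendsto_norm[OF lim] _ G(2)]) simp
      show "norm (l f - S f) \<le> \<epsilon> / 4"
        using k_near[OF f]
        by (intro tendsto_upperbound[OF tendsto_norm[OF tendsto_diff[OF lim tendsto_const]] _ G(2)]) simp
    qed
    have "k n x0 = S (u n)" for n
    proof -
      have "(\<lambda>z. \<xi> z * ((u n z * x0 z) * x0 z)) = (\<lambda>z. \<xi> z * u n z)"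
        by (rule ext) (use x0A in \<open>force simp: \<xi>_def indicator_def\<close>)
      then have "S (\<lambda>z. \<xi> z * ((u n z * x0 z) * x0 z)) = S (\<lambda>z. \<xi> z * u n z)" by simp
      then show ?thesis unfolding S_\<xi> k_def .
    qed
    then have "((\<lambda>n. norm (S (u n))) \<longlongrightarrow> norm (l x0)) G"
      using tendsto_norm[OF l[OF ball(1)[OF x0]]] by simp
    moreover have "((\<lambda>n. norm (S (u n))) \<longlongrightarrow> s0) G"
      using u_lim G(1) by (rule tendsto_mono[rotated])
    ultimately have l_x0: "norm (l x0) = s0" by (rule tendsto_unique[OF G(2)])
    define s where "s f = inverse s0 *\<^sub>R l f" for f
    show "\<exists>s L x0. lin_ess M s \<and> compact L \<and> s ` ess_ball M \<subseteq> L \<and>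
        (\<forall>f\<in>ess_ball M. norm (s f) \<le> 1) \<and> x0 \<in> ess_ball M \<and> norm (s x0) = 1 \<and>
        (\<forall>f\<in>ess_ball M. norm (s f - t f) \<le> \<epsilon>) \<and> (AE z in M. \<bar>x z - x0 z\<bar> \<le> \<epsilon>)"
    proof (intro exI conjI ballI)
      show "lin_ess M s"
        unfolding s_def[abs_def]
        by (intro lin_ess_compose[OF _ lin_l] bounded_linear.linear bounded_linear_scaleR_right)
      show "compact ((*\<^sub>R) (inverse s0) ` L)" by (intro compact_scaling \<open>compact L\<close>)
      show "s ` ess_ball M \<subseteq> (*\<^sub>R) (inverse s0) ` L" using l_L by (auto simp: s_def)
      show "x0 \<in> ess_ball M" by fact
      show "norm (s x0) = 1" using l_x0 s0 by (simp add: s_def)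
      show "AE z in M. \<bar>x z - x0 z\<bar> \<le> \<epsilon>" using near by eventually_elim (use \<beta> in linarith)
      fix f assume f: "f \<in> ess_ball M"
      show "norm (s f) \<le> 1" using l_le[OF f] s0 by (simp add: s_def field_simps)
      have "s f - l f = (inverse s0 - 1) *\<^sub>R l f" by (simp add: s_def algebra_simps)
      then have "norm (s f - l f) \<le> (inverse s0 - 1) * s0"
        using l_le[OF f] s0 \<open>s0 \<le> 1\<close> one_le_inverse[of s0] by (simp add: mult_left_mono)
      then have "norm (s f - l f) \<le> \<alpha>" using s0 by (simp add: left_diff_distrib)
      moreover have "norm (s f - t f) \<le> norm (s f - l f) + norm (l f - S f) + norm (S f - t0 f) + norm (t f - t0 f)"
        by norm
      ultimately show "norm (s f - t f) \<le> \<epsilon>"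
        using l_near[OF f] S_near[OF f] t0_near[OF f] \<alpha> \<delta>_def by linarith
    qed
  qed
qed

text \<open>
  Pushing a norm-attaining compact operator towards the vector \<open>y0\<close> where it attains its norm makes
  the norm of the result attained only in the directions \<open>y0\<close> and \<open>- y0\<close>, even on the closure of the
  image of the unit ball: a limit of images whose norms tend to one must have functional value
  of modulus one, and strict convexity identifies it with a signed copy of \<open>y0\<close>.
\<close>

lemma strongly_exposing_perturbation:
  fixes t :: "('a \<Rightarrow> real) \<Rightarrow> 'y::real_normed_vector"
  assumes uc: "uniformly_convex TYPE('y)" and "\<delta> > 0"
    and t: "lin_ess M t" "compact K" "t ` ess_ball M \<subseteq> K" "\<And>f. f \<in> ess_ball M \<Longrightarrow> norm (t f) \<le> 1"
    and x0: "x0 \<in> ess_ball M" "norm (t x0) = 1"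
  obtains s L where "lin_ess M s" "compact L" "s ` ess_ball M \<subseteq> L"
    "\<And>f. f \<in> ess_ball M \<Longrightarrow> norm (s f) \<le> 1" "norm (s x0) = 1"
    "\<And>f. f \<in> ess_ball M \<Longrightarrow> norm (s f - t f) \<le> 2 * \<delta>"
    "\<And>u. (\<And>n::nat. u n \<in> ess_ball M) \<Longrightarrow> (\<lambda>n. norm (s (u n))) \<longlonglongrightarrow> 1 \<Longrightarrow>
      \<exists>\<sigma>::nat \<Rightarrow> nat. strict_mono \<sigma> \<and> (\<exists>\<theta>\<in>{1, -1::real}. (\<lambda>n. s (u (\<sigma> n))) \<longlonglongrightarrow> \<theta> *\<^sub>R s x0)"
proof -
  define y0 where "y0 = t x0"
  have y0: "norm y0 = 1" using x0 by (simp add: y0_def)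
  obtain \<phi> :: "'y \<Rightarrow> real" where \<phi>: "linear \<phi>" "\<And>y. \<bar>\<phi> y\<bar> \<le> norm y" "\<phi> y0 = 1"
    using norming_functional[of y0] y0 by metis
  note R_facts = \<phi>(1,2) y0(1) \<phi>(3) \<open>\<delta> > 0\<close>
  define R where "R = push \<delta> \<phi> y0"
  have R: "linear R" "R y0 = y0"
    unfolding R_def by (rule linear_push[OF R_facts], rule push_fixes[OF R_facts])
  have R_cont: "continuous_on B R" for B
    unfolding R_def by (rule continuous_push[OF R_facts])
  have exposed: "\<exists>\<theta>\<in>{1, -1::real}. y = \<theta> *\<^sub>R y0" if y: "norm y \<le> 1" "norm (R y) = 1" for y
  proof -
    have "1 + \<delta> \<le> norm y + \<delta> * \<bar>\<phi> y\<bar>"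
      using push_norm_bound[OF R_facts, of y] y(2) by (simp add: R_def)
    then have "\<delta> * 1 \<le> \<delta> * \<bar>\<phi> y\<bar>" using y(1) by linarith
    then have "\<bar>\<phi> y\<bar> \<ge> 1" using \<open>\<delta> > 0\<close> by simp
    then have abs: "\<bar>\<phi> y\<bar> = 1" "norm y = 1" using \<phi>(2)[of y] y(1) by linarith+
    define \<theta> where "\<theta> = \<phi> y"
    have \<theta>: "\<theta> = 1 \<or> \<theta> = -1" using abs unfolding \<theta>_def by linarith
    have "\<phi> (\<theta> *\<^sub>R y + y0) = 2"
      using \<theta> \<phi>(3) by (auto simp: linear_add[OF \<phi>(1)] linear_scale[OF \<phi>(1)] \<theta>_def)
    then have sum: "norm (\<theta> *\<^sub>R y + y0) / 2 \<ge> 1" using \<phi>(2)[of "\<theta> *\<^sub>R y + y0"] by simp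
    have "norm (\<theta> *\<^sub>R y - y0) < e" if "e > 0" for e
    proof -
      from uc that obtain d where "d > 0" and d: "\<And>y1 y2 :: 'y. norm y1 = 1 \<Longrightarrow> norm y2 = 1 \<Longrightarrow>
          norm (y1 + y2) / 2 > 1 - d \<Longrightarrow> norm (y1 - y2) < e"
        by (force simp: uniformly_convex_def)
      show ?thesis
        using \<theta> abs y0 sum \<open>d > 0\<close> by (intro d) auto
    qed
    then have "norm (\<theta> *\<^sub>R y - y0) \<le> 0" by (meson less_irrefl not_le)
    then have "y = \<theta> *\<^sub>R y0" using \<theta> by auto
    then show ?thesis using \<theta> by blast
  qed
  define s where "s f = R (t f)" for f
  have s_x0: "s x0 = y0" using R(2) by (simp add: s_def y0_def)
  show thesis
  proof
    show "lin_ess M s" unfolding s_def[abs_def] by (rule lin_ess_compose[OF R(1) t(1)])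
    show "compact (R ` K)" by (intro compact_continuous_image R_cont t)
    show "s ` ess_ball M \<subseteq> R ` K" using t(3) by (auto simp: s_def)
    show "norm (s x0) = 1" by (simp add: s_x0 y0)
    show "norm (s f) \<le> 1" if "f \<in> ess_ball M" for f
      using norm_push_le[OF R_facts, of "t f"] t(4)[OF that] by (simp add: s_def R_def)
    show "norm (s f - t f) \<le> 2 * \<delta>" if "f \<in> ess_ball M" for f
      using push_near[OF R_facts t(4)[OF that]] by (simp add: s_def R_def)
    fix u :: "nat \<Rightarrow> 'a \<Rightarrow> real"
    assume u: "\<And>n. u n \<in> ess_ball M" and lim: "(\<lambda>n. norm (s (u n))) \<longlonglongrightarrow> 1"
    have "t (u n) \<in> K" for n using u t(3) by blast
    then obtain y \<sigma> where \<sigma>: "strict_mono (\<sigma> :: nat \<Rightarrow> nat)" and "((\<lambda>n. t (u n)) \<circ> \<sigma>) \<longlonglongrightarrow> y"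
      using seq_compactE[OF compact_imp_seq_compact[OF t(2)], of "\<lambda>n. t (u n)"] by blast
    then have y: "(\<lambda>n. t (u (\<sigma> n))) \<longlonglongrightarrow> y" by (simp add: o_def)
    have "(\<lambda>n. s (u (\<sigma> n))) \<longlonglongrightarrow> R y"
      unfolding s_def using continuous_on_tendsto_compose[OF R_cont[of UNIV] y] by simp
    moreover from tendsto_norm[OF this] have "norm (R y) = 1"
      using LIMSEQ_subseq_LIMSEQ[OF lim \<sigma>] by (auto simp: o_def intro: LIMSEQ_unique)
    moreover have "norm y \<le> 1"
      using t(4)[OF u] by (intro tendsto_upperbound[OF tendsto_norm[OF y]]) auto
    ultimately obtain \<theta> where "\<theta> \<in> {1, -1::real}" "(\<lambda>n. s (u (\<sigma> n))) \<longlonglongrightarrow> R (\<theta> *\<^sub>R y0)"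
      using exposed[of y] by metis
    then have "(\<lambda>n. s (u (\<sigma> n))) \<longlonglongrightarrow> \<theta> *\<^sub>R s x0"
      by (simp add: s_x0 linear_scale[OF R(1)] R(2))
    then show "\<exists>\<sigma>::nat \<Rightarrow> nat. strict_mono \<sigma> \<and> (\<exists>\<theta>\<in>{1, -1::real}. (\<lambda>n. s (u (\<sigma> n))) \<longlonglongrightarrow> \<theta> *\<^sub>R s x0)"
      using \<sigma> \<open>\<theta> \<in> _\<close> by blast
  qed
qed

lemma BPBp_RSE_of_uniformly_convex:
  fixes M :: "'a measure"
  assumes uc: "uniformly_convex TYPE('y::real_normed_vector)"
  shows "BPBp_RSE (Linf M) (compact_ops (Linf M) :: (('a \<Rightarrow> real) set \<Rightarrow> 'y) set)"
  unfolding BPBp_RSE_def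
proof (intro allI impI)
  fix \<epsilon> :: real assume "\<epsilon> > 0"
  then have "\<epsilon> / 4 > 0" by simp
  obtain \<eta> where \<eta>: "0 < \<eta>" "\<eta> < \<epsilon> / 4" and approx:
    "\<forall>(t :: ('a \<Rightarrow> real) \<Rightarrow> 'y) K x. lin_ess M t \<and> compact K \<and> t ` ess_ball M \<subseteq> K \<and>
      (\<forall>f\<in>ess_ball M. norm (t f) \<le> 1) \<and> x \<in> ess_ball M \<and> norm (t x) > 1 - \<eta> \<longrightarrow>
      (\<exists>s L x0. lin_ess M s \<and> compact L \<and> s ` ess_ball M \<subseteq> L \<and>
        (\<forall>f\<in>ess_ball M. norm (s f) \<le> 1) \<and> x0 \<in> ess_ball M \<and> norm (s x0) = 1 \<and>
        (\<forall>f\<in>ess_ball M. norm (s f - t f) \<le> \<epsilon> / 4) \<and> (AE z in M. \<bar>x z - x0 z\<bar> \<le> \<epsilon> / 4))"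
    using norm_attaining_approximation[OF uc \<open>\<epsilon> / 4 > 0\<close>, of M] by (elim exE conjE) (rule that)
  show "\<exists>\<eta>>0. \<eta> < \<epsilon> \<and> (\<forall>T\<in>compact_ops (Linf M) :: (('a \<Rightarrow> real) set \<Rightarrow> 'y) set.
     \<forall>x\<in>unit_sphere (Linf M). op_norm (Linf M) T = 1 \<and> norm (T x) > 1 - \<eta> \<longrightarrow>
        (\<exists>S \<in> RSE (Linf M) \<inter> compact_ops (Linf M). \<exists>x0\<in>unit_sphere (Linf M).
           op_norm (Linf M) S = 1 \<and> norm (S x0) = 1 \<and>
           op_norm (Linf M) (\<lambda>z. S z - T z) < \<epsilon> \<and> nnorm (Linf M) (ndiff (Linf M) x x0) < \<epsilon>))"
  proof (intro exI[of _ \<eta>] conjI ballI impI)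
    show "0 < \<eta>" "\<eta> < \<epsilon>" using \<eta> \<open>\<epsilon> > 0\<close> by auto
    fix T :: "('a \<Rightarrow> real) set \<Rightarrow> 'y" and X
    assume T: "T \<in> compact_ops (Linf M)" and X: "X \<in> unit_sphere (Linf M)"
      and TX: "op_norm (Linf M) T = 1 \<and> norm (T X) > 1 - \<eta>"
    define t where "t f = T (cls M f)" for f
    have bT: "T \<in> bdd_ops (Linf M)" using T by (simp add: compact_ops_def)
    have t: "lin_ess M t" unfolding t_def by (rule bdd_op_lin_ess[OF bT])
    have t1: "norm (t f) \<le> 1" if "f \<in> ess_ball M" for f
      using norm_le_op_norm[OF bT that] TX by (simp add: t_def)
    define K where "K = closure (T ` unit_ball (Linf M))"
    have K: "compact K" "t ` ess_ball M \<subseteq> K"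
      using T closure_subset[of "T ` unit_ball (Linf M)"]
      by (auto simp: K_def compact_ops_def unit_ball_Linf t_def)
    have "X \<in> unit_ball (Linf M)" using X by (simp add: unit_ball_def unit_sphere_def)
    then obtain x where x: "x \<in> ess_ball M" "X = cls M x" by (auto simp: unit_ball_Linf)
    have "norm (t x) > 1 - \<eta>" using TX x by (simp add: t_def)
    then have "lin_ess M t \<and> compact K \<and> t ` ess_ball M \<subseteq> K \<and>
        (\<forall>f\<in>ess_ball M. norm (t f) \<le> 1) \<and> x \<in> ess_ball M \<and> norm (t x) > 1 - \<eta>"
      using t K t1 x(1) by blast
    from approx[rule_format, OF this] obtain s1 L1 x0 where
      s1: "lin_ess M s1" "compact L1" "s1 ` ess_ball M \<subseteq> L1" "\<And>f. f \<in> ess_ball M \<Longrightarrow> norm (s1 f) \<le> 1"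
      and x0: "x0 \<in> ess_ball M" "norm (s1 x0) = 1"
      and s1_t: "\<And>f. f \<in> ess_ball M \<Longrightarrow> norm (s1 f - t f) \<le> \<epsilon> / 4"
      and x_x0: "AE z in M. \<bar>x z - x0 z\<bar> \<le> \<epsilon> / 4"
      by blast
    have "\<epsilon> / 8 > 0" using \<open>\<epsilon> > 0\<close> by simp
    from strongly_exposing_perturbation[OF uc this s1 x0] obtain s L where
      s: "lin_ess M s" "compact L" "s ` ess_ball M \<subseteq> L" "\<And>f. f \<in> ess_ball M \<Longrightarrow> norm (s f) \<le> 1"
      and s_x0: "norm (s x0) = 1"
      and s_s1: "\<And>f. f \<in> ess_ball M \<Longrightarrow> norm (s f - s1 f) \<le> 2 * (\<epsilon> / 8)"
      and rse: "\<And>u. (\<And>n::nat. u n \<in> ess_ball M) \<Longrightarrow> (\<lambda>n. norm (s (u n))) \<longlonglongrightarrow> 1 \<Longrightarrow>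
        \<exists>\<sigma>::nat \<Rightarrow> nat. strict_mono \<sigma> \<and> (\<exists>\<theta>\<in>{1, -1::real}. (\<lambda>n. s (u (\<sigma> n))) \<longlonglongrightarrow> \<theta> *\<^sub>R s x0)"
      by metis
    define S where "S = lift M s"
    have S_cls: "S (cls M f) = s f" if "f \<in> ess_ball M" for f
      unfolding S_def by (rule lift_cls[OF s(1,4) ess_ballD(3)[OF that]])
    have bS: "S \<in> bdd_ops (Linf M)" unfolding S_def by (rule lift_in_bdd_ops[OF s(1,4)])
    have S_comp: "S \<in> compact_ops (Linf M)"
      using s(3) by (intro compact_opsI[OF bS s(2)]) (auto simp: unit_ball_Linf S_cls)
    have "op_norm (Linf M) S \<le> 1" by (rule op_norm_le) (simp add: S_cls s)
    then have S1: "op_norm (Linf M) S = 1"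
      using norm_le_op_norm[OF bS x0(1)] s_x0 by (simp add: S_cls x0)
    have x0_carr: "cls M x0 \<in> carr (Linf M)" "cls M x0 \<in> unit_ball (Linf M)"
      using x0(1) by (auto simp: carr_Linf unit_ball_Linf ess_ballD)
    \<comment> \<open>A contraction of norm one at \<open>x0\<close> forces \<open>x0\<close> onto the unit sphere.\<close>
    have "nnorm (Linf M) (cls M x0) \<ge> 1"
    proof -
      have "norm (s x0) \<le> 1 * nnorm (Linf M) (cls M x0)"
        using Linf_norm_nonneg[OF x0_carr(1)] Linf_norm_le_iff[OF ess_ballD(3)[OF x0(1)]]
        by (intro lin_ess_bound[OF s(1,4)] ess_ballD(3)[OF x0(1)]) auto
      then show ?thesis using s_x0 by simp
    qed
    then have x0_sphere: "cls M x0 \<in> unit_sphere (Linf M)"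
      using x0_carr by (auto simp: unit_ball_def unit_sphere_def)
    have "S \<in> RSE (Linf M)"
    proof -
      have "\<exists>\<sigma>::nat \<Rightarrow> nat. strict_mono \<sigma> \<and>
          (\<exists>\<theta>\<in>{1, -1::real}. (\<lambda>n. S (U (\<sigma> n))) \<longlonglongrightarrow> \<theta> *\<^sub>R S (cls M x0))"
        if U: "\<And>n::nat. U n \<in> unit_ball (Linf M)" "(\<lambda>n. norm (S (U n))) \<longlonglongrightarrow> op_norm (Linf M) S" for U
      proof -
        have "\<exists>f. f \<in> ess_ball M \<and> U n = cls M f" for n using U(1)[of n] by (auto simp: unit_ball_Linf)
        then obtain u where u: "\<And>n. u n \<in> ess_ball M" "\<And>n. U n = cls M (u n)" by metis
        show ?thesis using rse[of u] U(2) by (simp add: u S_cls S1 x0)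
      qed
      then show ?thesis using bS x0_sphere unfolding RSE_def by blast
    qed
    show "\<exists>S \<in> RSE (Linf M) \<inter> compact_ops (Linf M). \<exists>x0\<in>unit_sphere (Linf M).
           op_norm (Linf M) S = 1 \<and> norm (S x0) = 1 \<and>
           op_norm (Linf M) (\<lambda>z. S z - T z) < \<epsilon> \<and> nnorm (Linf M) (ndiff (Linf M) X x0) < \<epsilon>"
    proof (intro bexI conjI)
      show "S \<in> RSE (Linf M) \<inter> compact_ops (Linf M)" using \<open>S \<in> RSE _\<close> S_comp by blast
      show "cls M x0 \<in> unit_sphere (Linf M)" "op_norm (Linf M) S = 1" by fact+
      show "norm (S (cls M x0)) = 1" using s_x0 by (simp add: S_cls x0)
      have "norm (S (cls M f) - T (cls M f)) \<le> \<epsilon> / 2" if f: "f \<in> ess_ball M" for f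
        using s1_t[OF f] s_s1[OF f] norm_triangle_ineq[of "s f - s1 f" "s1 f - t f"]
        by (simp add: S_cls f t_def)
      then have "op_norm (Linf M) (\<lambda>z. S z - T z) \<le> \<epsilon> / 2" by (rule op_norm_le)
      then show "op_norm (Linf M) (\<lambda>z. S z - T z) < \<epsilon>" using \<open>\<epsilon> > 0\<close> by simp
      have "nnorm (Linf M) (ndiff (Linf M) X (cls M x0)) \<le> \<epsilon> / 4"
        unfolding x(2) Linf_diff_class[OF ess_ballD(3)[OF x(1)] ess_ballD(3)[OF x0(1)]]
        using x_x0 \<open>\<epsilon> > 0\<close>
        by (subst Linf_norm_le_iff) (auto intro!: ess_bounded_diff ess_ballD(3)[OF x(1)] ess_ballD(3)[OF x0(1)])
      then show "nnorm (Linf M) (ndiff (Linf M) X (cls M x0)) < \<epsilon>" using \<open>\<epsilon> > 0\<close> by simp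
    qed
  qed
qed

section \<open>Necessity of uniform convexity\<close>

text \<open>
  A generalised limit of point evaluations along the sets of full measure in \<open>A\<close>. Averaging over \<open>A\<close>
  would not do, since \<open>A\<close> may have infinite measure without subsets of finite positive measure.
\<close>

lemma mean_on:
  fixes M :: "'a measure"
  assumes A: "A \<in> sets M" "emeasure M A \<noteq> 0"
  shows "\<exists>m :: ('a \<Rightarrow> real) \<Rightarrow> real. lin_ess M m \<and>
    (\<forall>f\<in>ess_bounded M. \<forall>c. (AE z in M. z \<in> A \<longrightarrow> \<bar>f z\<bar> \<le> c) \<longrightarrow> \<bar>m f\<bar> \<le> c) \<and> m (\<lambda>z. 1) = 1"
proof -
  define F where "F = inf (ae_filter M) (principal A)"
  have ev: "eventually P F \<longleftrightarrow> (AE z in M. z \<in> A \<longrightarrow> P z)" for P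
    by (simp add: F_def eventually_inf_principal)
  have "F \<noteq> bot"
  proof
    assume "F = bot"
    then have "AE z in M. z \<notin> A" using ev[of "\<lambda>_. False"] by simp
    then show False using A AE_iff_null_sets[OF A(1)] by auto
  qed
  have "\<exists>c. AE z in M. \<bar>f z\<bar> \<le> c" if "f \<in> ess_bounded M" for f
    using that by (simp add: ess_bounded_iff)
  then obtain c where c: "\<And>f. f \<in> ess_bounded M \<Longrightarrow> AE z in M. \<bar>f z\<bar> \<le> c f" by metis
  have range: "eventually (\<lambda>z. f z \<in> {- c f..c f}) F" if "f \<in> ess_bounded M" for f
    unfolding ev using c[OF that] by eventually_elim (auto simp: abs_le_iff)
  obtain G m where G: "G \<le> F" "G \<noteq> bot"
    and m: "\<And>f. f \<in> ess_bounded M \<Longrightarrow> ((\<lambda>z. f z) \<longlongrightarrow> m f) G"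
    by (rule simultaneous_limits[OF \<open>F \<noteq> bot\<close>, of "ess_bounded M" "\<lambda>f. {- c f..c f}" "\<lambda>z f. f z"])
      (use range in auto)
  show ?thesis
  proof (intro exI[of _ m] conjI ballI allI impI)
    show "lin_ess M m"
      by (rule lin_ess_limit[OF G(2) _ m]) (simp add: lin_ess_def)
    show "m (\<lambda>z. 1) = 1"
      using tendsto_unique[OF G(2) m[OF const_ess_bounded] tendsto_const] .
    fix f c assume f: "f \<in> ess_bounded M" and le: "AE z in M. z \<in> A \<longrightarrow> \<bar>f z\<bar> \<le> c"
    have "eventually (\<lambda>z. \<bar>f z\<bar> \<le> c) G"
      using filter_leD[OF G(1)] le ev by blast
    then show "\<bar>m f\<bar> \<le> c"
      by (rule tendsto_upperbound[OF tendsto_rabs[OF m[OF f]] _ G(2)])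
  qed
qed

text \<open>
  The constant is the essential supremum of \<open>f\<close>, that is, the infimum of the real numbers that bound
  \<open>f\<close> from above almost everywhere.
\<close>

lemma AE_constant_if_trivial_measure:
  assumes triv: "\<And>A. A \<in> sets M \<Longrightarrow> emeasure M A = 0 \<or> emeasure M (space M - A) = 0"
    and f: "f \<in> ess_bounded M"
  shows "\<exists>c. AE z in M. f z = c"
proof (cases "AE z in M. False")
  case True
  then show ?thesis by (auto elim: eventually_mono)
next
  case False
  define Q where "Q = {q. AE z in M. f z \<le> q}"
  obtain C where C: "AE z in M. \<bar>f z\<bar> \<le> C" using f by (auto simp: ess_bounded_iff)
  have [measurable]: "f \<in> borel_measurable M" using f by (simp add: ess_bounded_def)
  have "C \<in> Q" using C by (auto simp: Q_def elim: eventually_mono)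
  have "- C \<le> q" if "q \<in> Q" for q
  proof (rule ccontr)
    assume "\<not> - C \<le> q"
    from that have "AE z in M. f z \<le> q" by (simp add: Q_def)
    with C have "AE z in M. False" by eventually_elim (use \<open>\<not> - C \<le> q\<close> in linarith)
    with False show False ..
  qed
  then have bdd: "bdd_below Q" by (rule bdd_belowI)
  define c where "c = Inf Q"
  have "AE z in M. f z \<le> c + 1 / real (Suc n) \<and> c - 1 / real (Suc n) \<le> f z" for n
  proof -
    have "\<exists>q\<in>Q. q < c + 1 / real (Suc n)"
      unfolding c_def using \<open>C \<in> Q\<close> by (intro cInf_lessD) auto
    then obtain q where q: "AE z in M. f z \<le> q" "q < c + 1 / real (Suc n)" by (auto simp: Q_def)
    define r where "r = c - 1 / real (Suc n)"
    have "r \<notin> Q" using cInf_lower[OF _ bdd, of r] by (auto simp: c_def r_def)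
    define A where "A = {z \<in> space M. f z \<le> r}"
    have A: "A \<in> sets M" unfolding A_def by measurable
    have "emeasure M (space M - A) \<noteq> 0"
    proof
      assume "emeasure M (space M - A) = 0"
      then have "space M - A \<in> null_sets M" using A by auto
      then have "AE z in M. z \<notin> space M - A" by (rule AE_not_in)
      with AE_space have "AE z in M. f z \<le> r" by eventually_elim (simp add: A_def)
      then show False using \<open>r \<notin> Q\<close> by (simp add: Q_def)
    qed
    then have "A \<in> null_sets M" using triv[OF A] A by auto
    then have "AE z in M. z \<notin> A" by (rule AE_not_in)
    with AE_space q(1) show ?thesis by eventually_elim (use q(2) in \<open>auto simp: A_def r_def\<close>)
  qed
  then have "AE z in M. \<forall>n. f z \<le> c + 1 / real (Suc n) \<and> c - 1 / real (Suc n) \<le> f z"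
    by (simp add: AE_all_countable)
  then have "AE z in M. f z = c"
  proof eventually_elim
    case (elim z)
    have "\<bar>f z - c\<bar> \<le> e" if e: "e > 0" for e
    proof -
      obtain n where "1 / real (Suc n) < e" by (rule nat_approx_posE[OF e])
      then show ?thesis using elim[rule_format, of n] by linarith
    qed
    then have "\<bar>f z - c\<bar> \<le> 0 + e" if "e > 0" for e unfolding add_0_left using that by blast
    then have "\<bar>f z - c\<bar> \<le> 0" by (rule field_le_epsilon)
    then show ?case by simp
  qed
  then show ?thesis ..
qed

text \<open>
  Otherwise every essentially bounded function is constant almost everywhere, and two constants are
  linearly dependent.
\<close>

lemma splitting_set:
  assumes "ndim_ge_2 (Linf M)"
  obtains A where "A \<in> sets M" "emeasure M A \<noteq> 0" "emeasure M (space M - A) \<noteq> 0"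
proof (rule ccontr)
  assume "\<not> thesis"
  then have triv: "\<And>A. A \<in> sets M \<Longrightarrow> emeasure M A = 0 \<or> emeasure M (space M - A) = 0"
    using that by blast
  from assms obtain F G where FG: "F \<in> carr (Linf M)" "G \<in> carr (Linf M)"
    and indep: "\<forall>a b. nadd (Linf M) (nscale (Linf M) a F) (nscale (Linf M) b G) = nzero (Linf M)
      \<longrightarrow> a = 0 \<and> b = 0"
    unfolding ndim_ge_2_def by (elim bexE) (rule that)
  obtain f g where f: "f \<in> ess_bounded M" "F = cls M f" and g: "g \<in> ess_bounded M" "G = cls M g"
    using FG unfolding carr_Linf by blast
  have zero: "a = 0 \<and> b = 0" if "AE z in M. a * f z + b * g z = 0" for a b
  proof (rule indep[rule_format])
    have "nadd (Linf M) (nscale (Linf M) a F) (nscale (Linf M) b G) = cls M (\<lambda>z. a * f z + b * g z)"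
      by (simp add: Linf_scale_class Linf_add_class f g ess_bounded_scale)
    also have "\<dots> = cls M (\<lambda>z. 0)"
      using that f(1) g(1) by (simp add: cls_eq_iff ess_bounded_add ess_bounded_scale const_ess_bounded)
    finally show "nadd (Linf M) (nscale (Linf M) a F) (nscale (Linf M) b G) = nzero (Linf M)" by (simp add: Linf_def)
  qed
  obtain a b where ab: "AE z in M. f z = a" "AE z in M. g z = b"
    using AE_constant_if_trivial_measure[OF triv] f(1) g(1) by metis
  have "AE z in M. b * f z + (- a) * g z = 0" using ab by eventually_elim simp
  then have "a = 0" using zero[of b "- a"] by simp
  then have "AE z in M. f z = 0" using ab(1) by simp
  then show False using zero[of 1 0] by simp
qed

text \<open>
  If \<open>y1\<close> and \<open>y2\<close> are unit vectors far apart whose midpoint is almost of norm one, the operator that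
  takes the indicator functions of \<open>A\<close> and of its complement \<open>B\<close> to \<open>(y1 + y2) / 2\<close> and
  \<open>(y1 - y2) / 2\<close> almost attains its norm at the first one. A point \<open>x0\<close> near it leaves room on \<open>B\<close>:
  an operator \<open>S\<close> attaining its norm at \<open>x0\<close> has norm one on the whole segment \<open>x0 + c 1\<^sub>B\<close> with
  \<open>\<bar>c\<bar> \<le> 1/2\<close>. Range strong exposition leaves only two possible images for its points, hence \<open>S\<close>
  annihilates the indicator of \<open>B\<close> and cannot be close to the given operator.
\<close>

lemma uniformly_convex_of_BPBp_RSE:
  fixes M :: "'a measure"
  assumes BPB: "BPBp_RSE (Linf M) (compact_ops (Linf M) :: (('a \<Rightarrow> real) set \<Rightarrow> 'y::real_normed_vector) set)"
    and dim: "ndim_ge_2 (Linf M)"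
  shows "uniformly_convex TYPE('y)"
  unfolding uniformly_convex_def
proof (intro allI impI, rule ccontr)
  fix e :: real
  assume "e > 0" and not_uc: "\<not> (\<exists>\<delta>. 0 < \<delta> \<and> \<delta> < (1::real) \<and>
     (\<forall>y1 y2 :: 'y. norm y1 = 1 \<and> norm y2 = 1 \<and> norm (y1 + y2) / 2 > 1 - \<delta> \<longrightarrow> norm (y1 - y2) < e))"
  define \<epsilon> where "\<epsilon> = min (e / 4) (1/2)"
  have \<epsilon>: "0 < \<epsilon>" "\<epsilon> \<le> e / 4" "\<epsilon> \<le> 1/2" unfolding \<epsilon>_def using \<open>e > 0\<close> by linarith+
  obtain \<eta> where \<eta>: "0 < \<eta>" "\<eta> < \<epsilon>" and approx:
    "\<forall>T\<in>compact_ops (Linf M) :: (('a \<Rightarrow> real) set \<Rightarrow> 'y) set. \<forall>X\<in>unit_sphere (Linf M).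
      op_norm (Linf M) T = 1 \<and> norm (T X) > 1 - \<eta> \<longrightarrow>
      (\<exists>S \<in> RSE (Linf M) \<inter> compact_ops (Linf M). \<exists>x0\<in>unit_sphere (Linf M).
           op_norm (Linf M) S = 1 \<and> norm (S x0) = 1 \<and>
           op_norm (Linf M) (\<lambda>z. S z - T z) < \<epsilon> \<and> nnorm (Linf M) (ndiff (Linf M) X x0) < \<epsilon>)"
    using BPB[unfolded BPBp_RSE_def, rule_format, OF \<open>0 < \<epsilon>\<close>] by (elim exE conjE) (rule that)
  have "\<eta> < 1" using \<eta> \<epsilon> by linarith
  with not_uc \<eta>(1) obtain y1 y2 :: 'y where "norm y1 = 1" "norm y2 = 1"
    "norm (y1 + y2) / 2 > 1 - \<eta>" "\<not> norm (y1 - y2) < e" by blast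
  then have y: "norm y1 = 1" "norm y2 = 1" "norm (y1 + y2) / 2 > 1 - \<eta>" "norm (y1 - y2) \<ge> e"
    by auto
  obtain A where A: "A \<in> sets M" "emeasure M A \<noteq> 0" "emeasure M (space M - A) \<noteq> 0"
    using splitting_set[OF dim] .
  define B where "B = space M - A"
  have B: "B \<in> sets M" "emeasure M B \<noteq> 0" using A by (auto simp: B_def)
  obtain p :: "('a \<Rightarrow> real) \<Rightarrow> real" where p: "lin_ess M p"
    "\<forall>f\<in>ess_bounded M. \<forall>c. (AE z in M. z \<in> A \<longrightarrow> \<bar>f z\<bar> \<le> c) \<longrightarrow> \<bar>p f\<bar> \<le> c"
    "p (\<lambda>z. 1) = 1"
    using mean_on[OF A(1,2)] by (elim exE conjE) (rule that)
  obtain q :: "('a \<Rightarrow> real) \<Rightarrow> real" where q: "lin_ess M q"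
    "\<forall>f\<in>ess_bounded M. \<forall>c. (AE z in M. z \<in> B \<longrightarrow> \<bar>f z\<bar> \<le> c) \<longrightarrow> \<bar>q f\<bar> \<le> c"
    "q (\<lambda>z. 1) = 1"
    using mean_on[OF B] by (elim exE conjE) (rule that)
  have iA: "indicat_real A \<in> ess_ball M" and iB: "indicat_real B \<in> ess_ball M"
    using A(1) B(1) by (auto intro: indicator_in_ess_ball)
  note iAb = ess_ballD(3)[OF iA] and iBb = ess_ballD(3)[OF iB]
  have pq: "p (indicat_real A) = 1" "p (indicat_real B) = 0" "q (indicat_real A) = 0" "q (indicat_real B) = 1"
  proof -
    have "\<bar>p (\<lambda>z. indicat_real A z - 1)\<bar> \<le> 0"
      by (rule p(2)[rule_format]) (auto intro!: ess_bounded_diff iAb const_ess_bounded)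
    then show "p (indicat_real A) = 1" using p(3) by (simp add: lin_ess_diff[OF p(1)] iAb const_ess_bounded)
    have "\<bar>q (\<lambda>z. indicat_real B z - 1)\<bar> \<le> 0"
      by (rule q(2)[rule_format]) (auto intro!: ess_bounded_diff iBb const_ess_bounded)
    then show "q (indicat_real B) = 1" using q(3) by (simp add: lin_ess_diff[OF q(1)] iBb const_ess_bounded)
    have "\<bar>p (indicat_real B)\<bar> \<le> 0" by (rule p(2)[rule_format, OF iBb]) (auto simp: B_def)
    then show "p (indicat_real B) = 0" by simp
    have "\<bar>q (indicat_real A)\<bar> \<le> 0" by (rule q(2)[rule_format, OF iAb]) (auto simp: B_def)
    then show "q (indicat_real A) = 0" by simp
  qed
  define v where "v = (1/2) *\<^sub>R (y1 + y2)"
  define w where "w = (1/2) *\<^sub>R (y1 - y2)"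
  have vw: "v + w = y1" "norm v > 1 - \<eta>" "norm w \<ge> e / 2"
    using y by (simp_all add: v_def w_def flip: scaleR_add_right)
  define J where "J = (\<lambda>ab::real \<times> real. fst ab *\<^sub>R v + snd ab *\<^sub>R w)"
  define K where "K = J ` ({-1..1} \<times> {-1..1})"
  have "compact K"
    unfolding K_def J_def
    by (intro compact_continuous_image compact_Times compact_Icc continuous_intros)
  \<comment> \<open>In the coordinates \<open>(a + b) / 2\<close> and \<open>(a - b) / 2\<close> the map \<open>J\<close> combines \<open>y1\<close> and \<open>y2\<close>, and
    \<open>(\<bar>a + b\<bar> + \<bar>a - b\<bar>) / 2\<close> is the maximum of \<open>\<bar>a\<bar>\<close> and \<open>\<bar>b\<bar>\<close>.\<close>
  have J_le: "norm (J (a, b)) \<le> 1" if "\<bar>a\<bar> \<le> 1" "\<bar>b\<bar> \<le> 1" for a b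
  proof -
    have "J (a, b) = ((a + b) / 2) *\<^sub>R y1 + ((a - b) / 2) *\<^sub>R y2"
      by (simp add: J_def v_def w_def algebra_simps add_divide_distrib diff_divide_distrib)
    then have "norm (J (a, b)) \<le> \<bar>(a + b) / 2\<bar> + \<bar>(a - b) / 2\<bar>"
      using norm_triangle_ineq[of "((a + b) / 2) *\<^sub>R y1" "((a - b) / 2) *\<^sub>R y2"] y by simp
    also have "\<dots> \<le> 1"
    proof -
      have "\<bar>a + b\<bar> + \<bar>a - b\<bar> \<le> 2" using that by linarith
      then show ?thesis by simp
    qed
    finally show ?thesis .
  qed
  define t where "t f = J (p f, q f)" for f
  have t: "lin_ess M t"
    using p(1) q(1) by (simp add: lin_ess_def t_def J_def algebra_simps)
  have pq_le: "\<bar>p f\<bar> \<le> 1" "\<bar>q f\<bar> \<le> 1" if "f \<in> ess_ball M" for f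
    using ess_ballD(2,3)[OF that] by (auto intro!: p(2)[rule_format] q(2)[rule_format] elim: eventually_mono)
  have t_le: "norm (t f) \<le> 1" if "f \<in> ess_ball M" for f
    unfolding t_def by (intro J_le pq_le that)
  have t_K: "t f \<in> K" if "f \<in> ess_ball M" for f
    using pq_le[OF that] by (auto simp: t_def K_def abs_le_iff intro!: imageI)
  define T where "T = lift M t"
  have T_cls: "T (cls M f) = t f" if "f \<in> ess_bounded M" for f
    unfolding T_def by (rule lift_cls[OF t t_le that])
  have bT: "T \<in> bdd_ops (Linf M)" unfolding T_def by (rule lift_in_bdd_ops[OF t t_le])
  have T: "T \<in> compact_ops (Linf M)"
    using t_K by (intro compact_opsI[OF bT \<open>compact K\<close>]) (auto simp: unit_ball_Linf T_cls ess_ballD(3))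
  have one: "(\<lambda>z. 1) \<in> ess_ball M" by (simp add: ess_ball_def)
  have "t (\<lambda>z. 1) = y1" by (simp add: t_def p q J_def vw)
  then have "1 \<le> op_norm (Linf M) T"
    using norm_le_op_norm[OF bT one] y by (simp add: T_cls const_ess_bounded)
  moreover have "op_norm (Linf M) T \<le> 1"
    by (rule op_norm_le) (simp add: T_cls ess_ballD(3) t_le)
  ultimately have T1: "op_norm (Linf M) T = 1" by simp
  have TA: "norm (T (cls M (indicat_real A))) > 1 - \<eta>" and TB: "norm (T (cls M (indicat_real B))) \<ge> e / 2"
    using vw by (simp_all add: T_cls iAb iBb t_def pq J_def)
  have A_sphere: "cls M (indicat_real A) \<in> unit_sphere (Linf M)"
  proof -
    have "c \<ge> 1" if c: "nnorm (Linf M) (cls M (indicat_real A)) \<le> c" "c \<ge> 0" for c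
    proof -
      have "AE z in M. z \<in> A \<longrightarrow> \<bar>indicat_real A z\<bar> \<le> c"
        using c(1) unfolding Linf_norm_le_iff[OF iAb c(2)]
        by eventually_elim (auto simp: indicator_def)
      from p(2)[rule_format, OF iAb this] show ?thesis by (simp add: pq)
    qed
    moreover have "cls M (indicat_real A) \<in> unit_ball (Linf M)" using iA by (simp add: unit_ball_Linf)
    ultimately show ?thesis
      using Linf_norm_nonneg by (force simp: unit_sphere_def unit_ball_def)
  qed
  from approx[rule_format, OF T A_sphere conjI[OF T1 TA]] obtain S X0 where
    S: "S \<in> RSE (Linf M)" and X0: "X0 \<in> unit_sphere (Linf M)"
    and S1: "op_norm (Linf M) S = 1" "norm (S X0) = 1"
    and ST: "op_norm (Linf M) (\<lambda>z. S z - T z) < \<epsilon>"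
    and dist: "nnorm (Linf M) (ndiff (Linf M) (cls M (indicat_real A)) X0) < \<epsilon>" by blast
  have bS: "S \<in> bdd_ops (Linf M)" using S by (simp add: RSE_def)
  have "X0 \<in> unit_ball (Linf M)" using X0 by (simp add: unit_ball_def unit_sphere_def)
  then obtain x0 where x0: "x0 \<in> ess_ball M" "X0 = cls M x0" by (auto simp: unit_ball_Linf)
  note x0b = ess_ballD(3)[OF x0(1)]
  define s where "s f = S (cls M f)" for f
  have s: "lin_ess M s" unfolding s_def by (rule bdd_op_lin_ess[OF bS])
  have "AE z in M. \<bar>indicat_real A z - x0 z\<bar> \<le> \<epsilon>"
    using dist \<epsilon>(1) Linf_norm_le_iff[OF ess_bounded_diff[OF iAb x0b], of \<epsilon>]
    by (simp add: x0(2) Linf_diff_class[OF iAb x0b])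
  then have small: "AE z in M. \<bar>x0 z\<bar> \<le> 1 \<and> (z \<in> B \<longrightarrow> \<bar>x0 z\<bar> \<le> 1/2)"
    using ess_ballD(2)[OF x0(1)] by eventually_elim (use \<epsilon>(3) in \<open>auto simp: B_def\<close>)
  have ball: "(\<lambda>z. x0 z + c * indicat_real B z) \<in> ess_ball M" if "\<bar>c\<bar> \<le> 1/2" for c
  proof (rule ess_ballI)
    show "AE z in M. \<bar>x0 z + c * indicat_real B z\<bar> \<le> 1"
      using small by eventually_elim (use that in \<open>auto simp: indicator_def\<close>)
  qed (use x0b iBb in \<open>auto simp: ess_bounded_def\<close>)
  define d where "d = s (indicat_real B)"
  have s_line: "s (\<lambda>z. x0 z + c * indicat_real B z) = s x0 + c *\<^sub>R d" for c
    by (simp add: d_def lin_ess_add[OF s] lin_ess_scale[OF s] x0b iBb ess_bounded_scale)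
  have line_le: "norm (s x0 + c *\<^sub>R d) \<le> 1" if "\<bar>c\<bar> \<le> 1/2" for c
    using norm_le_op_norm[OF bS ball[OF that]] by (simp add: S1 flip: s_line) (simp add: s_def)
  have line: "norm (s x0 + c *\<^sub>R d) = 1" if "\<bar>c\<bar> \<le> 1/2" for c
  proof -
    have "(s x0 + c *\<^sub>R d) + (s x0 + (- c) *\<^sub>R d) = 2 *\<^sub>R s x0" by (simp add: scaleR_2)
    moreover have "norm (s x0) = 1" using S1(2) by (simp add: s_def x0(2))
    ultimately have "2 \<le> norm (s x0 + c *\<^sub>R d) + norm (s x0 + (- c) *\<^sub>R d)"
      using norm_triangle_ineq[of "s x0 + c *\<^sub>R d" "s x0 + (- c) *\<^sub>R d"] by simp
    then show ?thesis using line_le[of c] line_le[of "- c"] that by simp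
  qed
  from S obtain X1 where X1: "\<And>u::nat \<Rightarrow> ('a \<Rightarrow> real) set. (\<And>n. u n \<in> unit_ball (Linf M)) \<Longrightarrow>
      (\<lambda>n. norm (S (u n))) \<longlonglongrightarrow> op_norm (Linf M) S \<Longrightarrow>
      \<exists>\<sigma>::nat \<Rightarrow> nat. \<exists>\<theta>\<in>{1, -1::real}. (\<lambda>n. S (u (\<sigma> n))) \<longlonglongrightarrow> \<theta> *\<^sub>R S X1"
    unfolding RSE_def by blast
  have two_values: "s x0 + c *\<^sub>R d = S X1 \<or> s x0 + c *\<^sub>R d = - S X1" if "\<bar>c\<bar> \<le> 1/2" for c
  proof -
    let ?f = "\<lambda>z. x0 z + c * indicat_real B z"
    have "\<exists>\<sigma>::nat \<Rightarrow> nat. \<exists>\<theta>\<in>{1, -1::real}. (\<lambda>n. S (cls M ?f)) \<longlonglongrightarrow> \<theta> *\<^sub>R S X1"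
      by (rule X1[of "\<lambda>_. cls M ?f"])
        (use ball[OF that] line[OF that] in \<open>auto simp: unit_ball_Linf S1 s_def[symmetric] s_line\<close>)
    then have "s ?f = S X1 \<or> s ?f = - S X1"
      by (auto simp: LIMSEQ_const_iff s_def)
    then show ?thesis unfolding s_line .
  qed
  have "d = 0"
  proof -
    have diff: "d = (s x0 + (1/2) *\<^sub>R d) - (s x0 + (-1/2) *\<^sub>R d)"
      by (simp flip: scaleR_left_distrib)
    have "s x0 + (1/2) *\<^sub>R d = s x0 \<or> s x0 + (1/2) *\<^sub>R d = - s x0"
      "s x0 + (-1/2) *\<^sub>R d = s x0 \<or> s x0 + (-1/2) *\<^sub>R d = - s x0"
      using two_values[of 0] two_values[of "1/2"] two_values[of "-1/2"] by auto
    then consider "(1/2) *\<^sub>R d = 0" | "(-1/2) *\<^sub>R d = 0"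
      | "s x0 + (1/2) *\<^sub>R d = s x0 + (-1/2) *\<^sub>R d"
      by (metis add_cancel_right_right)
    then show ?thesis
    proof cases
      case 3
      then show ?thesis using diff by simp
    qed simp_all
  qed
  then have "norm (T (cls M (indicat_real B))) \<le> op_norm (Linf M) (\<lambda>z. S z - T z)"
    using norm_le_op_norm[OF bdd_ops_diff[OF bS bT] iB] by (simp add: d_def s_def)
  then show False using ST TB \<epsilon> \<open>e > 0\<close> by linarith
qed

theorem corollary4p3:
  fixes M :: "'a measure"
  assumes "\<exists>B :: 'y::banach set. independent B \<and> card B = 2"
    and "ndim_ge_2 (Linf M)"
  shows "BPBp_RSE (Linf M) (compact_ops (Linf M) :: (('a \<Rightarrow> real) set \<Rightarrow> 'y) set)
    \<longleftrightarrow> uniformly_convex TYPE('y)"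
  using BPBp_RSE_of_uniformly_convex uniformly_convex_of_BPBp_RSE[OF _ assms(2)] by blast

end
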